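(* Let $p=p(N)\in[0,1]$ be such that $\frac{\log N}{Np}=o(1)$ as $N\to\infty$. For every $\varepsilon>0$ and all sufficiently large $N$ the following holds. Let $G_{N,p}$ be the Erdős–Rényi random graph, let $C\in\mathbb{N}_+$, and let $W_l\in\mathbb{R}^{C\times C}$ ($l\in\mathbb{N}_+$) be the weights of a GCN on $G_{N,p}$, with $s:=\sup_{l\in\mathbb{N}_+}s_l$, where $s_l$ is the maximum singular value of $W_l$. If $$s<s_0:=\frac17\sqrt{\frac{Np-p+1}{\log(4N/\varepsilon)}},$$ then with probability at least $1-\varepsilon$ (over $G_{N,p}$) one has $s\lambda<1$, where $\lambda=\lambda(G_{N,p})$ is the spectral quantity defined in the context.
   Context: $G_{N,p}$ is the random graph on $N$ nodes in which each edge between two distinct nodes appears independently with probability $p$. For a graph $G$ on $[N]$ with adjacency matrix $A$, degree matrix $D$ and $M$ connected components, let $\tilde A=A+I_N$, $\tilde D=D+I_N$, $P=\tilde D^{-1/2}\tilde A\tilde D^{-1/2}$, let $\lambda_1\le\cdots\le\lambda_N$ be the eigenvalues of $P$ (the top $M$ of which equal $1$), and $\lambda(G):=\max_{n=1,\dots,N-M}|\lambda_n|$ (equal to $0$ if $M=N$). A GCN on $G$ with weights $W_l$ is the sequence of maps $f_l(X)=\sigma(PXW_l)$ on $\mathbb{R}^{N\times C}$, $\sigma$ the element-wise ReLU. The threshold $N$ for "sufficiently large" depends only on $\varepsilon$ and the function $p(\cdot)$. *)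

theory Defs
  imports "HOL-Probability.Product_PMF" "HOL-Library.Landau_Symbols"
    "Jordan_Normal_Form.Char_Poly"
begin

(* A simple graph on N nodes is given by its set of edges, each edge being a two-element
   subset of {..<N}: nodes are numbered from 0 to match the indexing of matrix entries. *)

definition possible_edges :: "nat \<Rightarrow> nat set set" where
  "possible_edges N = {e. e \<subseteq> {..<N} \<and> card e = 2}"

definition gnp :: "nat \<Rightarrow> real \<Rightarrow> nat set set pmf" where
  "gnp N p = map_pmf (\<lambda>f. {e \<in> possible_edges N. f e})
     (Pi_pmf (possible_edges N) False (\<lambda>_. bernoulli_pmf p))"

definition adjacency_matrix :: "nat \<Rightarrow> nat set set \<Rightarrow> real mat" where
  "adjacency_matrix N E = Matrix.mat N N (\<lambda>(i, j). if {i, j} \<in> E then 1 else 0)"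

definition degree_matrix :: "nat \<Rightarrow> nat set set \<Rightarrow> real mat" where
  "degree_matrix N E = Matrix.mat N N (\<lambda>(i, j). if i = j then real (card {e \<in> E. i \<in> e}) else 0)"

definition num_components :: "nat \<Rightarrow> nat set set \<Rightarrow> nat" where
  "num_components N E =
     card ({..<N} // ({(u, v). {u, v} \<in> E}\<^sup>* \<inter> {..<N} \<times> {..<N}))"

(* The power -1/2 of a diagonal matrix with positive diagonal entries. *)
definition diag_inv_sqrt :: "real mat \<Rightarrow> real mat" where
  "diag_inv_sqrt D =
     Matrix.mat (dim_row D) (dim_col D) (\<lambda>(i, j). if i = j then 1 / sqrt (D $$ (i, i)) else 0)"

definition augmented_adjacency :: "nat \<Rightarrow> nat set set \<Rightarrow> real mat" where
  "augmented_adjacency N E = adjacency_matrix N E + 1\<^sub>m N"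

definition augmented_degree :: "nat \<Rightarrow> nat set set \<Rightarrow> real mat" where
  "augmented_degree N E = degree_matrix N E + 1\<^sub>m N"

definition propagation_matrix :: "nat \<Rightarrow> nat set set \<Rightarrow> real mat" where
  "propagation_matrix N E =
     diag_inv_sqrt (augmented_degree N E) * augmented_adjacency N E *
     diag_inv_sqrt (augmented_degree N E)"

(* Real eigenvalues in increasing order, repeated according to algebraic multiplicity;
   for a symmetric matrix of size N this list has length N. *)
definition sorted_eigenvalues :: "real mat \<Rightarrow> real list" where
  "sorted_eigenvalues A = sorted_list_of_multiset (proots (char_poly A))"

(* Lists are indexed from 0, so index n here corresponds to the (n + 1)-st smallest eigenvalue:
   the maximum runs over all but the num_components N E largest eigenvalues. *)
definition graph_lambda :: "nat \<Rightarrow> nat set set \<Rightarrow> real" where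
  "graph_lambda N E =
     (let M = num_components N E
      in if M = N then 0
         else Max ((\<lambda>n. \<bar>sorted_eigenvalues (propagation_matrix N E) ! n\<bar>) ` {..<N - M}))"

definition singular_values :: "real mat \<Rightarrow> real set" where
  "singular_values W = {sqrt x | x. eigenvalue (transpose_mat W * W) x}"

definition max_singular_value :: "real mat \<Rightarrow> real" where
  "max_singular_value W = Max (singular_values W)"

(* The supremum is taken in the extended reals since the weights need not be bounded. *)
definition sup_singular_value :: "(nat \<Rightarrow> real mat) \<Rightarrow> ereal" where
  "sup_singular_value W = (SUP l\<in>{1..}. ereal (max_singular_value (W l)))"

end

theory Submission
  imports Defs "HOL-Computational_Algebra.Fundamental_Theorem_Algebra" "HOL-Real_Asymp.Real_Asymp"
begin

text \<open>Discarding the top eigenvalue of \<open>P\<close> amounts to controlling \<open>P\<close> up to an arbitrary rank one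
  form, and \<open>P - p D'^(-1/2) J D'^(-1/2)\<close>, with \<open>J\<close> the all-ones matrix and \<open>D'\<close> the augmented degree
  matrix, is bounded by \<open>(t + 1) / m\<close>, where \<open>t\<close> is the spectral norm of the centred adjacency matrix \<open>X\<close>
  and \<open>m\<close> the smallest augmented degree. A Chernoff bound gives \<open>m \<ge> 6/7 (Np - p + 1)\<close>. For \<open>t\<close> the trace
  method applies: in the expansion of \<open>tr X^(2k)\<close> over walks only those traversing every edge at least twice
  have nonzero expectation, whence \<open>E tr X^(2k) \<le> N (8kNp)^k\<close>. With \<open>k\<close> about \<open>log N\<close> and Markov's
  inequality, \<open>t\<^sup>2 \<le> 32 Np log N\<close> with probability tending to 1, and \<open>7/6 * sqrt 32 < 7\<close>.\<close>

unbundle no vec_syntax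
unbundle no inner_syntax

subsection \<open>Diagonalization of real symmetric matrices\<close>

text \<open>The obstacle is the count of walks in which every edge is repeated. No classification of
  walk shapes is made. Instead a weight with a free parameter \<theta> \<ge> 1 dominates the
  expected product along a walk and is summed one vertex at a time: a step costs at most
  \<open>N p / \<theta>\<close> for fresh edges plus \<open>2 k \<theta>\<close> for reused ones.
  Balancing the two gives the base \<open>sqrt (8 k N p)\<close>. The price is a factor of order
  \<open>sqrt k\<close> beyond \<open>sqrt (N p)\<close>, and with k near \<open>ln N\<close> this
  is the logarithm that the bound on s leaves room for. The growth hypothesis enters as
  \<open>10000 ln N \<le> N p\<close> for large N, which admits \<theta> \<ge> 1, pays for the union
  bound over N degrees and makes the 1 in \<open>t + 1\<close> negligible. Both failure
  probabilities are at most constant multiples of fixed negative powers of N, so each eventually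
  falls below \<epsilon> / 2.\<close>

lemma symmetric_real_eigenvector:
  fixes A :: "real mat"
  assumes A: "A \<in> carrier_mat n n" and n: "n > 0" and sym: "transpose_mat A = A"
  obtains v e where "v \<in> carrier_vec n" "v \<bullet> v = 1" "A *\<^sub>v v = e \<cdot>\<^sub>v v"
proof -
  define cA where "cA = map_mat complex_of_real A"
  have cA: "cA \<in> carrier_mat n n"
    using A by (simp add: cA_def)
  have "degree (char_poly cA) \<noteq> 0"
    using degree_monic_char_poly[OF cA] n by simp
  then obtain z where "poly (char_poly cA) z = 0"
    using fundamental_theorem_of_algebra[of "char_poly cA"] constant_degree[of "char_poly cA"] by auto
  then obtain v where v: "v \<in> carrier_vec n" "v \<noteq> 0\<^sub>v n" "cA *\<^sub>v v = z \<cdot>\<^sub>v v"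
    using eigenvalue_root_char_poly[OF cA] cA by (auto simp: eigenvalue_def eigenvector_def)
  define a where "a i = Re (v $ i)" for i
  define b where "b i = Im (v $ i)" for i
  have row: "(\<Sum>j<n. complex_of_real (A $$ (i,j)) * v $ j) = z * v $ i" if "i < n" for i
  proof -
    have "(cA *\<^sub>v v) $ i = (\<Sum>j<n. complex_of_real (A $$ (i,j)) * v $ j)"
      using that A v(1) by (simp add: cA_def scalar_prod_def lessThan_atLeast0)
    then show ?thesis using v that by simp
  qed
  have Aa: "(\<Sum>j<n. A $$ (i,j) * a j) = Re z * a i - Im z * b i" if "i < n" for i
    using arg_cong[OF row[OF that], of Re] by (simp add: a_def b_def)
  have Ab: "(\<Sum>j<n. A $$ (i,j) * b j) = Re z * b i + Im z * a i" if "i < n" for i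
    using arg_cong[OF row[OF that], of Im] by (simp add: a_def b_def algebra_simps)
  have symA: "A $$ (i,j) = A $$ (j,i)" if "i < n" "j < n" for i j
    using arg_cong[OF sym, of "\<lambda>B. B $$ (i,j)"] that A by simp
  \<comment> \<open>With v = a + i b, symmetry equates the bilinear form at (b, a) and at (a, b);
    the difference of the two sides is \<open>Im z\<close> times the squared norm of v.\<close>
  have "(\<Sum>i<n. b i * (\<Sum>j<n. A $$ (i,j) * a j)) = (\<Sum>i<n. \<Sum>j<n. b i * a j * A $$ (i,j))"
    by (simp add: sum_distrib_left mult_ac)
  also have "\<dots> = (\<Sum>j<n. \<Sum>i<n. b i * a j * A $$ (i,j))"
    by (rule sum.swap)
  also have "\<dots> = (\<Sum>j<n. a j * (\<Sum>i<n. A $$ (j,i) * b i))"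
    by (auto simp: sum_distrib_left mult_ac symA intro!: sum.cong)
  finally have "(\<Sum>i<n. b i * (Re z * a i - Im z * b i)) = (\<Sum>i<n. a i * (Re z * b i + Im z * a i))"
    by (simp add: Aa Ab)
  then have "Im z * (\<Sum>i<n. (a i)\<^sup>2 + (b i)\<^sup>2) = 0"
    by (simp add: algebra_simps sum.distrib sum_distrib_left sum_subtractf power2_eq_square)
  moreover have "(\<Sum>i<n. (a i)\<^sup>2 + (b i)\<^sup>2) \<noteq> 0"
  proof
    assume "(\<Sum>i<n. (a i)\<^sup>2 + (b i)\<^sup>2) = 0"
    then have "(a i)\<^sup>2 + (b i)\<^sup>2 = 0" if "i < n" for i
      using that by (subst (asm) sum_nonneg_eq_0_iff) auto
    then have "v $ i = 0" if "i < n" for i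
      using that by (auto simp: a_def b_def complex_eq_iff sum_power2_eq_zero_iff)
    then have "v = 0\<^sub>v n" using v(1) by auto
    then show False using v(2) by simp
  qed
  ultimately have im: "Im z = 0" by simp
  have "\<exists>c. (\<exists>i<n. c i \<noteq> 0) \<and> (\<forall>i<n. (\<Sum>j<n. A $$ (i,j) * c j) = Re z * c i)"
  proof (cases "\<exists>i<n. a i \<noteq> 0")
    case True
    then show ?thesis using Aa im by auto
  next
    case False
    have "\<exists>i<n. b i \<noteq> 0"
    proof (rule ccontr)
      assume "\<not> ?thesis"
      then have "v = 0\<^sub>v n" using False v(1) by (auto simp: a_def b_def complex_eq_iff)
      then show False using v(2) by simp
    qed
    then show ?thesis using Ab im by auto
  qed
  then obtain c k where c: "k < n" "c k \<noteq> 0" "\<And>i. i < n \<Longrightarrow> (\<Sum>j<n. A $$ (i,j) * c j) = Re z * c i"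
    by auto
  define r where "r = sqrt (\<Sum>i<n. (c i)\<^sup>2)"
  have "(\<Sum>i<n. (c i)\<^sup>2) > 0"
    using c by (intro sum_pos2[of _ k]) auto
  then have r: "r > 0" "r\<^sup>2 = (\<Sum>i<n. (c i)\<^sup>2)" by (auto simp: r_def)
  define u where "u = Matrix.vec n (\<lambda>i. c i / r)"
  have "u \<bullet> u = (\<Sum>i<n. (c i)\<^sup>2) / r\<^sup>2"
    by (simp add: u_def scalar_prod_def lessThan_atLeast0 power2_eq_square sum_divide_distrib)
  then have "u \<bullet> u = 1" using r by (metis divide_self less_numeral_extra(3) zero_less_power)
  moreover have "A *\<^sub>v u = Re z \<cdot>\<^sub>v u"
  proof (rule eq_vecI)
    fix i assume "i < dim_vec (Re z \<cdot>\<^sub>v u)"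
    then have i: "i < n" by (simp add: u_def)
    have "(A *\<^sub>v u) $ i = (\<Sum>j<n. A $$ (i,j) * c j) / r"
      using i A by (simp add: u_def scalar_prod_def lessThan_atLeast0 sum_divide_distrib)
    then show "(A *\<^sub>v u) $ i = (Re z \<cdot>\<^sub>v u) $ i"
      using c(3)[OF i] i by (simp add: u_def)
  qed (use A in \<open>simp add: u_def\<close>)
  moreover have "u \<in> carrier_vec n" by (simp add: u_def)
  ultimately show ?thesis using that by blast
qed

text \<open>The Householder reflection exchanging \<^term>\<open>v\<close> and the first unit vector.\<close>
lemma reflection_to_first_unit_vector:
  fixes v :: "real vec"
  assumes v: "v \<in> carrier_vec (Suc n)" "v \<bullet> v = 1"
  obtains H where "H \<in> carrier_mat (Suc n) (Suc n)" "transpose_mat H = H"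
    "H * H = 1\<^sub>m (Suc n)" "col H 0 = v"
proof (cases "v = unit_vec (Suc n) 0")
  case True
  show ?thesis
    by (rule that[of "1\<^sub>m (Suc n)"]) (use True in auto)
next
  case False
  define w where "w i = v $ i - (if i = 0 then 1 else 0)" for i
  define s where "s = (\<Sum>i<Suc n. (w i)\<^sup>2)"
  have vv: "(\<Sum>i<Suc n. (v $ i)\<^sup>2) = 1"
    using v by (simp add: scalar_prod_def lessThan_atLeast0 power2_eq_square)
  have "s = (\<Sum>i<Suc n. (v $ i)\<^sup>2 + (if i = 0 then 1 - 2 * v $ i else 0))"
    unfolding s_def by (intro sum.cong) (auto simp: w_def power2_eq_square algebra_simps)
  also have "\<dots> = 2 - 2 * v $ 0"
    by (simp add: sum.distrib vv del: sum.lessThan_Suc)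
  finally have s0: "s = - 2 * w 0" by (simp add: w_def)
  have s: "s \<noteq> 0"
  proof
    assume "s = 0"
    then have "w i = 0" if "i < Suc n" for i
      using that unfolding s_def by (subst (asm) sum_nonneg_eq_0_iff) auto
    then have "v = unit_vec (Suc n) 0"
      using v(1) by (intro eq_vecI) (auto simp: w_def)
    then show False using False by simp
  qed
  define H where "H = Matrix.mat (Suc n) (Suc n)
    (\<lambda>(i,j). (if i = j then 1 else 0) - 2 * w i * w j / s)"
  have H: "H \<in> carrier_mat (Suc n) (Suc n)" by (simp add: H_def)
  have HH: "H * H = 1\<^sub>m (Suc n)"
  proof (rule eq_matI)
    fix i j assume "i < dim_row (1\<^sub>m (Suc n))" "j < dim_col (1\<^sub>m (Suc n))"
    then have ij: "i < Suc n" "j < Suc n" by auto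
    let ?d = "\<lambda>i j. if i = j then 1 else (0::real)"
    have "(H * H) $$ (i,j) = (\<Sum>k<Suc n. H $$ (i,k) * H $$ (k,j))"
      using ij H by (simp add: scalar_prod_def lessThan_atLeast0 del: sum.lessThan_Suc sum.op_ivl_Suc)
    also have "\<dots> = (\<Sum>k<Suc n. (?d i k - 2 * w i * w k / s) * (?d k j - 2 * w k * w j / s))"
      using ij by (intro sum.cong) (auto simp: H_def)
    also have "\<dots> = (\<Sum>k<Suc n. (if k = i then ?d k j else 0) - (if k = j then 2 * w i * w k / s else 0)
       - (if k = i then 2 * w k * w j / s else 0) + 4 * w i * w j / s\<^sup>2 * (w k)\<^sup>2)"
      by (intro sum.cong) (auto simp: algebra_simps power2_eq_square)
    also have "\<dots> = ?d i j - 2 * w i * w j / s - 2 * w i * w j / s + 4 * w i * w j / s\<^sup>2 * s"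
      using ij unfolding s_def sum_distrib_left by (simp add: sum.distrib sum_subtractf del: sum.lessThan_Suc)
    also have "\<dots> = 1\<^sub>m (Suc n) $$ (i,j)"
      using s ij by (simp add: power2_eq_square)
    finally show "(H * H) $$ (i,j) = 1\<^sub>m (Suc n) $$ (i,j)" .
  qed (use H in auto)
  \<comment> \<open>Since \<open>s = - 2 * w 0\<close>, the first column of H is the first unit
    vector plus w, which is v.\<close>
  have wH: "2 * w i * w 0 / s = - w i" for i
    using s by (simp add: s0)
  have "col H 0 = v"
  proof (rule eq_vecI)
    fix i assume "i < dim_vec v"
    then have "i < Suc n" using v(1) by simp
    then show "col H 0 $ i = v $ i"
      using wH[of i] by (auto simp: H_def) (auto simp: w_def)
  qed (use v H in auto)
  moreover have "transpose_mat H = H"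
    by (rule eq_matI) (auto simp: H_def)
  ultimately show ?thesis using that H HH by blast
qed

definition diagonal :: "real list \<Rightarrow> real mat" where
  "diagonal es = Matrix.mat (length es) (length es) (\<lambda>(i,j). if i = j then es ! i else 0)"

text \<open>Deflation: conjugation by a reflection whose first column is a unit eigenvector splits
  off a 1 by 1 block, because symmetry clears the first row along with the first column. The
  induction hypothesis diagonalizes the remaining block.\<close>

theorem symmetric_real_diagonalization:
  fixes A :: "real mat"
  assumes "A \<in> carrier_mat n n" "transpose_mat A = A"
  shows "\<exists>U es. U \<in> carrier_mat n n \<and> transpose_mat U * U = 1\<^sub>m n \<and> U * transpose_mat U = 1\<^sub>m n \<and>
    length es = n \<and> A = U * diagonal es * transpose_mat U"
  using assms
proof (induction n arbitrary: A)
  case 0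
  show ?case
    by (rule exI[of _ "1\<^sub>m 0"], rule exI[of _ "[]"]) (use 0 in \<open>auto simp: diagonal_def\<close>)
next
  case (Suc n)
  note A = Suc.prems(1) and symA = Suc.prems(2)
  obtain v e where v: "v \<in> carrier_vec (Suc n)" "v \<bullet> v = 1" "A *\<^sub>v v = e \<cdot>\<^sub>v v"
    using symmetric_real_eigenvector[OF A _ symA] by blast
  obtain H where H: "H \<in> carrier_mat (Suc n) (Suc n)" and HT: "transpose_mat H = H"
    and HH: "H * H = 1\<^sub>m (Suc n)" and Hv: "col H 0 = v"
    using reflection_to_first_unit_vector[OF v(1,2)] by blast
  define B where "B = H * A * H"
  have B: "B \<in> carrier_mat (Suc n) (Suc n)" using H A by (simp add: B_def)
  have BT: "transpose_mat B = B"
    using H A HT symA unfolding B_def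
    by (metis (no_types, lifting) assoc_mult_mat mult_carrier_mat transpose_mult)
  have "B = H * (A * H)"
    unfolding B_def using H A by (intro assoc_mult_mat)
  then have "col B 0 = H *\<^sub>v col (A * H) 0"
    using H A col_mult2[of H "Suc n" "Suc n" "A * H" "Suc n" 0] by simp
  also have "H *\<^sub>v col (A * H) 0 = H *\<^sub>v (A *\<^sub>v col H 0)"
    using H A by (subst col_mult2[of _ "Suc n" "Suc n" _ "Suc n"]) auto
  also have "\<dots> = e \<cdot>\<^sub>v (H *\<^sub>v col H 0)"
    using v H Hv by (simp add: mult_mat_vec)
  also have "H *\<^sub>v col H 0 = col (H * H) 0"
    using H by (intro col_mult2[symmetric]) auto
  finally have colB: "col B 0 = e \<cdot>\<^sub>v unit_vec (Suc n) 0"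
    by (simp add: HH)
  have B_sym: "B $$ (i,j) = B $$ (j,i)" if "i < Suc n" "j < Suc n" for i j
    using arg_cong[OF BT, of "\<lambda>B. B $$ (i,j)"] that B by simp
  have B_i0: "B $$ (i,0) = (if i = 0 then e else 0)" if "i < Suc n" for i
    using arg_cong[OF colB, of "\<lambda>x. x $ i"] that B by simp
  define A' where "A' = Matrix.mat n n (\<lambda>(i,j). B $$ (Suc i, Suc j))"
  have A': "A' \<in> carrier_mat n n" by (simp add: A'_def)
  have "transpose_mat A' = A'"
    by (rule eq_matI) (auto simp: A'_def B_sym)
  then obtain U es where U: "U \<in> carrier_mat n n" "transpose_mat U * U = 1\<^sub>m n"
      "U * transpose_mat U = 1\<^sub>m n" "length es = n" "A' = U * diagonal es * transpose_mat U"
    using Suc.IH[OF A'] by blast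
  define V where "V = four_block_mat (1\<^sub>m 1) (0\<^sub>m 1 n) (0\<^sub>m n 1) U"
  have V: "V \<in> carrier_mat (Suc n) (Suc n)" using U by (auto simp: V_def)
  have VT: "transpose_mat V = four_block_mat (1\<^sub>m 1) (0\<^sub>m 1 n) (0\<^sub>m n 1) (transpose_mat U)"
    unfolding V_def using U by (subst transpose_four_block_mat[of _ 1 1 _ n _ n]) auto
  have block: "four_block_mat X (0\<^sub>m 1 n) (0\<^sub>m n 1) Y * four_block_mat X' (0\<^sub>m 1 n) (0\<^sub>m n 1) Y'
      = four_block_mat (X * X') (0\<^sub>m 1 n) (0\<^sub>m n 1) (Y * Y')"
    if "X \<in> carrier_mat 1 1" "X' \<in> carrier_mat 1 1" "Y \<in> carrier_mat n n" "Y' \<in> carrier_mat n n"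
    for X Y X' Y' :: "real mat"
    using that by (subst mult_four_block_mat[of _ 1 1 _ n _ n _ _ 1 _ n]) auto
  have VTV: "transpose_mat V * V = 1\<^sub>m (Suc n)"
    unfolding VT unfolding V_def using U by (subst block) auto
  have VVT: "V * transpose_mat V = 1\<^sub>m (Suc n)"
    unfolding VT unfolding V_def using U by (subst block) auto
  define E where "E = Matrix.mat 1 1 (\<lambda>_. e)"
  have E: "E \<in> carrier_mat 1 1" by (simp add: E_def)
  have "diagonal (e # es) = four_block_mat E (0\<^sub>m 1 n) (0\<^sub>m n 1) (diagonal es)"
    using U(4) by (intro eq_matI) (auto simp: diagonal_def E_def nth_Cons split: nat.splits)
  moreover have D: "diagonal es \<in> carrier_mat n n" using U(4) by (simp add: diagonal_def)
  ultimately have "V * diagonal (e # es) * transpose_mat V = four_block_mat E (0\<^sub>m 1 n) (0\<^sub>m n 1) A'"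
    unfolding VT unfolding V_def U(5) using U(1) E D
    by (simp add: block del: One_nat_def)
  also have "\<dots> = B"
    using B B_sym B_i0 by (intro eq_matI) (auto simp: E_def A'_def)
  finally have VB: "V * diagonal (e # es) * transpose_mat V = B" .
  have De: "diagonal (e # es) \<in> carrier_mat (Suc n) (Suc n)" using U(4) by (simp add: diagonal_def)
  note assoc = assoc_mult_mat[of _ "Suc n" "Suc n" _ "Suc n" _ "Suc n"]
  have VTc: "transpose_mat V \<in> carrier_mat (Suc n) (Suc n)" using V by simp
  have HV: "transpose_mat (H * V) = transpose_mat V * H"
    using transpose_mult[OF H V] HT by simp
  have HHX: "H * (H * X) = X" if "X \<in> carrier_mat (Suc n) (Suc n)" for X
    using that H HH by (metis assoc_mult_mat left_mult_one_mat)
  have "transpose_mat (H * V) * (H * V) = 1\<^sub>m (Suc n)"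
    using H V VTc VTV HHX unfolding HV by (simp add: assoc)
  moreover have "(H * V) * transpose_mat (H * V) = 1\<^sub>m (Suc n)"
  proof -
    have "(H * V) * transpose_mat (H * V) = H * ((V * transpose_mat V) * H)"
      unfolding HV using H V VTc by (simp add: assoc)
    then show ?thesis using VVT HH H by simp
  qed
  moreover have "A = (H * V) * diagonal (e # es) * transpose_mat (H * V)"
  proof -
    have "(H * V) * diagonal (e # es) * transpose_mat (H * V) = H * B * H"
      unfolding HV VB[symmetric] using H V VTc De by (simp add: assoc)
    also have "\<dots> = A" unfolding B_def using H A HH HHX by (simp add: assoc)
    finally show ?thesis by simp
  qed
  moreover have "H * V \<in> carrier_mat (Suc n) (Suc n)" using H V by simp
  moreover have "length (e # es) = Suc n" using U by simp
  ultimately show ?case by blast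
qed

text \<open>Index form of the diagonalization, with \<open>u i k\<close> the i-th coordinate of the
  k-th eigenvector. Column orthonormality computes coordinates of combinations of eigenvectors, row
  orthonormality yields Parseval, and the characteristic polynomial identifies \<open>es\<close>
  with the multiset behind \<open>sorted_eigenvalues\<close>.\<close>

lemma symmetric_real_spectral:
  fixes A :: "real mat"
  assumes A: "A \<in> carrier_mat n n" and sym: "transpose_mat A = A"
  obtains u :: "nat \<Rightarrow> nat \<Rightarrow> real" and es where "length es = n"
    "\<And>k l. k < n \<Longrightarrow> l < n \<Longrightarrow> (\<Sum>i<n. u i k * u i l) = (if k = l then 1 else 0)"
    "\<And>i j. i < n \<Longrightarrow> j < n \<Longrightarrow> (\<Sum>k<n. u i k * u j k) = (if i = j then 1 else 0)"
    "\<And>i j. i < n \<Longrightarrow> j < n \<Longrightarrow> A $$ (i,j) = (\<Sum>k<n. es ! k * u i k * u j k)"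
    "char_poly A = (\<Prod>e\<leftarrow>es. [:- e, 1:])"
proof -
  obtain U es where U: "U \<in> carrier_mat n n" "transpose_mat U * U = 1\<^sub>m n"
      "U * transpose_mat U = 1\<^sub>m n" "length es = n" "A = U * diagonal es * transpose_mat U"
    using symmetric_real_diagonalization[OF A sym] by blast
  have D: "diagonal es \<in> carrier_mat n n" using U(4) by (simp add: diagonal_def)
  show ?thesis
  proof (rule that[of es "\<lambda>i k. U $$ (i,k)"])
    show "length es = n" by fact
  next
    fix k l assume "k < n" "l < n"
    then show "(\<Sum>i<n. U $$ (i,k) * U $$ (i,l)) = (if k = l then 1 else 0)"
      using arg_cong[OF U(2), of "\<lambda>B. B $$ (k,l)"] U(1) by (simp add: scalar_prod_def lessThan_atLeast0)
  next
    fix i j assume "i < n" "j < n"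
    then show "(\<Sum>k<n. U $$ (i,k) * U $$ (j,k)) = (if i = j then 1 else 0)"
      using arg_cong[OF U(3), of "\<lambda>B. B $$ (i,j)"] U(1) by (simp add: scalar_prod_def lessThan_atLeast0)
  next
    fix i j assume ij: "i < n" "j < n"
    have UD: "(U * diagonal es) $$ (i,k) = es ! k * U $$ (i,k)" if "k < n" for k
    proof -
      have "(U * diagonal es) $$ (i,k) = (\<Sum>l<n. U $$ (i,l) * diagonal es $$ (l,k))"
        using ij that U D by (simp add: scalar_prod_def lessThan_atLeast0)
      also have "\<dots> = (\<Sum>l<n. if l = k then U $$ (i,l) * es ! k else 0)"
        using U(4) that by (intro sum.cong) (auto simp: diagonal_def)
      finally show ?thesis using that by simp
    qed
    have "(X * transpose_mat U) $$ (i,j) = (\<Sum>k<n. X $$ (i,k) * U $$ (j,k))"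
      if "X \<in> carrier_mat n n" for X
      using that ij U(1) by (simp add: scalar_prod_def lessThan_atLeast0)
    from this[of "U * diagonal es"]
    have "A $$ (i,j) = (\<Sum>k<n. (U * diagonal es) $$ (i,k) * U $$ (j,k))"
      unfolding U(5) using U(1) D by simp
    then show "A $$ (i,j) = (\<Sum>k<n. es ! k * U $$ (i,k) * U $$ (j,k))"
      by (simp add: UD)
  next
    have "similar_mat A (diagonal es)"
      unfolding similar_mat_def similar_mat_wit_def Let_def using A U D
      by (intro exI[of _ U] exI[of _ "transpose_mat U"]) auto
    then have "char_poly A = char_poly (diagonal es)" by (rule char_poly_similar)
    also have "\<dots> = (\<Prod>e\<leftarrow>diag_mat (diagonal es). [:- e, 1:])"
      by (rule char_poly_upper_triangular[OF D]) (auto simp: diagonal_def)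
    also have "diag_mat (diagonal es) = es"
      by (rule nth_equalityI) (auto simp: diag_mat_def diagonal_def)
    finally show "char_poly A = (\<Prod>e\<leftarrow>es. [:- e, 1:])" .
  qed
qed

section \<open>Quadratic forms in an eigenbasis and rank one perturbation\<close>

lemma quadratic_form_spectral:
  fixes a u :: "nat \<Rightarrow> nat \<Rightarrow> real" and e y :: "nat \<Rightarrow> real"
  assumes "\<And>i j. i < n \<Longrightarrow> j < n \<Longrightarrow> a i j = (\<Sum>k<n. e k * u i k * u j k)"
  shows "(\<Sum>i<n. \<Sum>j<n. a i j * y i * y j) = (\<Sum>k<n. e k * (\<Sum>i<n. u i k * y i)\<^sup>2)"
proof -
  have "(\<Sum>i<n. \<Sum>j<n. a i j * y i * y j)
      = (\<Sum>i<n. \<Sum>j<n. \<Sum>k<n. e k * ((u i k * y i) * (u j k * y j)))"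
    by (intro sum.cong) (auto simp: assms sum_distrib_right sum_distrib_left mult_ac)
  also have "\<dots> = (\<Sum>i<n. \<Sum>k<n. \<Sum>j<n. e k * ((u i k * y i) * (u j k * y j)))"
    by (intro sum.cong refl sum.swap)
  also have "\<dots> = (\<Sum>k<n. \<Sum>i<n. \<Sum>j<n. e k * ((u i k * y i) * (u j k * y j)))"
    by (rule sum.swap)
  also have "\<dots> = (\<Sum>k<n. e k * (\<Sum>i<n. u i k * y i)\<^sup>2)"
    unfolding power2_eq_square sum_product by (simp add: sum_distrib_left)
  finally show ?thesis .
qed

text \<open>This is \<open>quadratic_form_spectral\<close> for the identity matrix, all of whose
  eigenvalues are 1.\<close>

lemma Parseval_orthonormal:
  fixes u :: "nat \<Rightarrow> nat \<Rightarrow> real" and y :: "nat \<Rightarrow> real"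
  assumes "\<And>i j. i < n \<Longrightarrow> j < n \<Longrightarrow> (\<Sum>k<n. u i k * u j k) = (if i = j then 1 else 0)"
  shows "(\<Sum>k<n. (\<Sum>i<n. u i k * y i)\<^sup>2) = (\<Sum>i<n. (y i)\<^sup>2)"
proof -
  have "(\<Sum>i<n. \<Sum>j<n. (if i = j then 1 else 0) * y i * y j) = (\<Sum>k<n. 1 * (\<Sum>i<n. u i k * y i)\<^sup>2)"
    by (rule quadratic_form_spectral) (simp add: assms)
  moreover have "(\<Sum>i<n. \<Sum>j<n. (if i = j then 1 else 0) * y i * y j) = (\<Sum>i<n. \<Sum>j<n. if j = i then (y i)\<^sup>2 else 0)"
    by (intro sum.cong) (auto simp: power2_eq_square)
  ultimately show ?thesis by simp
qed

lemma proots_prod_linear_factors: "proots (\<Prod>e\<leftarrow>es. [:- e, 1:]) = mset es" for es :: "real list"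
proof (induction es)
  case (Cons e es)
  have "(\<Prod>e\<leftarrow>es. [:- e, 1:]) \<noteq> 0" by (auto simp: prod_list_zero_iff)
  then show ?case using Cons by (simp add: proots_mult del: mult_pCons_left)
qed simp

text \<open>Two eigenvalues above \<^term>\<open>\<tau>\<close> would give a plane on which the form exceeds \<^term>\<open>\<tau>\<close>, and that plane
  meets the kernel of the functional \<^term>\<open>c\<close>.\<close>
lemma sorted_eigenvalues_rank_one_perturbation:
  fixes A :: "real mat" and c :: "nat \<Rightarrow> real"
  assumes A: "A \<in> carrier_mat n n" and sym: "transpose_mat A = A"
    and form: "\<And>y. \<bar>(\<Sum>i<n. \<Sum>j<n. A $$ (i,j) * y i * y j) - (\<Sum>i<n. c i * y i)\<^sup>2\<bar> \<le> \<tau> * (\<Sum>i<n. (y i)\<^sup>2)"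
    and k: "Suc k < n"
  shows "\<bar>sorted_eigenvalues A ! k\<bar> \<le> \<tau>"
proof -
  obtain u es where es: "length es = n"
    and u1: "\<And>k l. k < n \<Longrightarrow> l < n \<Longrightarrow> (\<Sum>i<n. u i k * u i l) = (if k = l then 1 else 0)"
    and u2: "\<And>i j. i < n \<Longrightarrow> j < n \<Longrightarrow> (\<Sum>k<n. u i k * u j k) = (if i = j then 1 else 0)"
    and Au: "\<And>i j. i < n \<Longrightarrow> j < n \<Longrightarrow> A $$ (i,j) = (\<Sum>k<n. es ! k * u i k * u j k)"
    and cp: "char_poly A = (\<Prod>e\<leftarrow>es. [:- e, 1:])"
    by (rule symmetric_real_spectral[OF A sym], rule that)
  have sorted: "sorted_eigenvalues A = sort es"
    by (simp add: sorted_eigenvalues_def cp proots_prod_linear_factors)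
  have form': "\<bar>(\<Sum>k<n. es ! k * (\<Sum>i<n. u i k * y i)\<^sup>2) - (\<Sum>i<n. c i * y i)\<^sup>2\<bar>
      \<le> \<tau> * (\<Sum>k<n. (\<Sum>i<n. u i k * y i)\<^sup>2)" for y
    using form[of y] quadratic_form_spectral[of n "\<lambda>i j. A $$ (i,j)" "\<lambda>k. es ! k" u y, OF Au]
      Parseval_orthonormal[of n u y, OF u2] by simp
  define g where "g k = (\<Sum>i<n. c i * u i k)" for k
  have plane: "\<bar>(es ! k * \<alpha>\<^sup>2 + es ! l * \<beta>\<^sup>2) - (\<alpha> * g k + \<beta> * g l)\<^sup>2\<bar> \<le> \<tau> * (\<alpha>\<^sup>2 + \<beta>\<^sup>2)"
    if kl: "k < n" "l < n" "k \<noteq> l" for k l \<alpha> \<beta>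
  proof -
    define y where "y i = \<alpha> * u i k + \<beta> * u i l" for i
    have "(\<Sum>i<n. u i m * y i) = \<alpha> * (\<Sum>i<n. u i m * u i k) + \<beta> * (\<Sum>i<n. u i m * u i l)" for m
      by (simp add: y_def sum.distrib sum_distrib_left algebra_simps)
    then have coord: "(\<Sum>i<n. u i m * y i) = (if m = k then \<alpha> else 0) + (if m = l then \<beta> else 0)" if "m < n" for m
      using that kl by (simp add: u1)
    have "(\<Sum>m<n. es ! m * (\<Sum>i<n. u i m * y i)\<^sup>2) = (\<Sum>m<n. (if m = k then es ! k * \<alpha>\<^sup>2 else 0) + (if m = l then es ! l * \<beta>\<^sup>2 else 0))"
      using kl by (intro sum.cong) (auto simp: coord)
    moreover have "(\<Sum>m<n. (\<Sum>i<n. u i m * y i)\<^sup>2) = (\<Sum>m<n. (if m = k then \<alpha>\<^sup>2 else 0) + (if m = l then \<beta>\<^sup>2 else 0))"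
      using kl by (intro sum.cong) (auto simp: coord)
    moreover have "(\<Sum>i<n. c i * y i) = \<alpha> * g k + \<beta> * g l"
      by (simp add: y_def g_def sum.distrib sum_distrib_left algebra_simps)
    ultimately show ?thesis using form'[of y] kl by (simp add: sum.distrib)
  qed
  \<comment> \<open>The form minus a square is at least \<open>- \<tau>\<close> on a unit
    eigenvector, and adding the square back only helps. The second index l exists because
    \<open>Suc k < n\<close> forces n \<ge> 2; it gets coefficient 0.\<close>
  have lower: "es ! m \<ge> - \<tau>" if m: "m < n" for m
  proof -
    obtain l where "l < n" "m \<noteq> l"
      using k by (metis Suc_lessD n_not_Suc_n)
    then have "\<bar>es ! m - (g m)\<^sup>2\<bar> \<le> \<tau>" using plane[of m l 1 0] m by simp
    moreover have "(g m)\<^sup>2 \<ge> 0" by simp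
    ultimately show ?thesis by linarith
  qed
  have unique: "k = l" if kl: "k < n" "l < n" "es ! k > \<tau>" "es ! l > \<tau>" for k l
  proof (rule ccontr)
    assume ne: "k \<noteq> l"
    \<comment> \<open>A nonzero vector of the plane on which the subtracted square vanishes.\<close>
    obtain \<alpha> \<beta> where ab: "\<alpha> * g k + \<beta> * g l = 0" "\<alpha> \<noteq> 0 \<or> \<beta> \<noteq> 0"
    proof (cases "g k = 0")
      case True
      then show ?thesis using that[of 1 0] by simp
    next
      case False
      then show ?thesis using that[of "g l" "- g k"] by simp
    qed
    have "es ! k * \<alpha>\<^sup>2 + es ! l * \<beta>\<^sup>2 \<le> \<tau> * \<alpha>\<^sup>2 + \<tau> * \<beta>\<^sup>2"
      using plane[OF kl(1,2) ne, of \<alpha> \<beta>] ab by (simp add: algebra_simps)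
    moreover have "\<tau> * \<alpha>\<^sup>2 + \<tau> * \<beta>\<^sup>2 < es ! k * \<alpha>\<^sup>2 + es ! l * \<beta>\<^sup>2"
    proof (cases "\<alpha> = 0")
      case True
      then show ?thesis using ab kl by simp
    next
      case False
      then show ?thesis using kl by (intro add_less_le_mono mult_strict_right_mono mult_right_mono) auto
    qed
    ultimately show False by simp
  qed
  \<comment> \<open>The list is increasing and k is not its last index, so a large entry at k would
    be followed by another one. Sorting preserves the number of large entries, which is at most
    one.\<close>
  have "\<not> sort es ! k > \<tau>"
  proof
    assume big: "sort es ! k > \<tau>"
    have "sort es ! k \<le> sort es ! (Suc k)"
      using k es by (intro sorted_nth_mono) auto
    then have "{k, Suc k} \<subseteq> {i. i < length (sort es) \<and> sort es ! i > \<tau>}"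
      using big k es by auto
    then have "card {k, Suc k} \<le> length (filter (\<lambda>e. e > \<tau>) (sort es))"
      unfolding length_filter_conv_card by (intro card_mono) auto
    also have "\<dots> = length (filter (\<lambda>e. e > \<tau>) es)"
      by (metis mset_filter mset_sort size_mset)
    also have "\<dots> = card {i. i < n \<and> es ! i > \<tau>}"
      by (simp add: length_filter_conv_card es)
    also have "\<dots> \<le> 1"
      using unique by (simp add: card_le_Suc0_iff_eq)
    finally show False by simp
  qed
  moreover have "sort es ! k \<in> set es"
    using k es by (metis Suc_lessD length_sort nth_mem set_sort)
  then have "sort es ! k \<ge> - \<tau>"
    using lower es by (metis in_set_conv_nth)
  ultimately show ?thesis by (simp add: sorted)
qed

section \<open>Traces of matrix powers\<close>

primrec matrix_power :: "nat \<Rightarrow> (nat \<Rightarrow> nat \<Rightarrow> real) \<Rightarrow> nat \<Rightarrow> nat \<Rightarrow> nat \<Rightarrow> real" where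
  "matrix_power n a 0 i j = (if i = j then 1 else 0)"
| "matrix_power n a (Suc k) i j = (\<Sum>l<n. a i l * matrix_power n a k l j)"

definition trace_power :: "nat \<Rightarrow> (nat \<Rightarrow> nat \<Rightarrow> real) \<Rightarrow> nat \<Rightarrow> real" where
  "trace_power n a k = (\<Sum>i<n. matrix_power n a k i i)"

text \<open>Each power has the same eigenvectors with powered eigenvalues, since column
  orthonormality collapses the double sum in a product; the trace then reads off their squared
  norms.\<close>

lemma trace_power_spectral:
  fixes a u :: "nat \<Rightarrow> nat \<Rightarrow> real" and e :: "nat \<Rightarrow> real"
  assumes u1: "\<And>k l. k < n \<Longrightarrow> l < n \<Longrightarrow> (\<Sum>i<n. u i k * u i l) = (if k = l then 1 else 0)"
    and u2: "\<And>i j. i < n \<Longrightarrow> j < n \<Longrightarrow> (\<Sum>k<n. u i k * u j k) = (if i = j then 1 else 0)"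
    and a: "\<And>i j. i < n \<Longrightarrow> j < n \<Longrightarrow> a i j = (\<Sum>k<n. e k * u i k * u j k)"
  shows "trace_power n a m = (\<Sum>k<n. e k ^ m)"
proof -
  have pow: "matrix_power n a m i j = (\<Sum>k<n. e k ^ m * u i k * u j k)" if "i < n" "j < n" for i j
    using that
  proof (induction m arbitrary: i)
    case 0
    then show ?case using u2 by simp
  next
    case (Suc m)
    have "matrix_power n a (Suc m) i j = (\<Sum>l<n. (\<Sum>k<n. e k * u i k * u l k) * (\<Sum>k<n. e k ^ m * u l k * u j k))"
      using Suc by (simp add: a)
    also have "\<dots> = (\<Sum>l<n. \<Sum>k<n. \<Sum>k'<n. e k * u i k * (e k' ^ m * u j k') * (u l k * u l k'))"
      by (simp add: sum_product mult_ac)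
    also have "\<dots> = (\<Sum>k<n. \<Sum>l<n. \<Sum>k'<n. e k * u i k * (e k' ^ m * u j k') * (u l k * u l k'))"
      by (rule sum.swap)
    also have "\<dots> = (\<Sum>k<n. \<Sum>k'<n. \<Sum>l<n. e k * u i k * (e k' ^ m * u j k') * (u l k * u l k'))"
      by (intro sum.cong refl sum.swap)
    also have "\<dots> = (\<Sum>k<n. \<Sum>k'<n. if k' = k then e k * u i k * (e k' ^ m * u j k') else 0)"
      by (intro sum.cong refl) (auto simp: sum_distrib_left[symmetric] u1)
    finally show ?case by (simp add: mult_ac)
  qed
  have "trace_power n a m = (\<Sum>i<n. \<Sum>k<n. e k ^ m * (u i k * u i k))"
    by (simp add: trace_power_def pow mult_ac)
  also have "\<dots> = (\<Sum>k<n. \<Sum>i<n. e k ^ m * (u i k * u i k))"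
    by (rule sum.swap)
  also have "\<dots> = (\<Sum>k<n. e k ^ m)"
    by (simp add: sum_distrib_left[symmetric] u1)
  finally show ?thesis .
qed

text \<open>Even powers make the trace a sum of nonnegative terms, so it dominates
  \<open>\<bar>e k\<bar> ^ (2 * m)\<close> for every single eigenvalue. Both claims share one
  diagonalization.\<close>

lemma
  fixes a :: "nat \<Rightarrow> nat \<Rightarrow> real"
  assumes sym: "\<And>i j. a i j = a j i"
  shows trace_power_even_nonneg: "trace_power n a (2 * m) \<ge> 0"
    and quadratic_form_le_trace_power:
      "\<lbrakk>trace_power n a (2 * m) \<le> t ^ (2 * m); m > 0; t \<ge> 0\<rbrakk>
        \<Longrightarrow> \<bar>\<Sum>i<n. \<Sum>j<n. a i j * y i * y j\<bar> \<le> t * (\<Sum>i<n. (y i)\<^sup>2)"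
proof -
  define A where "A = Matrix.mat n n (\<lambda>(i,j). a i j)"
  have A: "A \<in> carrier_mat n n" "transpose_mat A = A"
    unfolding A_def using sym by auto
  obtain u es where "length es = n"
    and u1: "\<And>k l. k < n \<Longrightarrow> l < n \<Longrightarrow> (\<Sum>i<n. u i k * u i l) = (if k = l then 1 else 0)"
    and u2: "\<And>i j. i < n \<Longrightarrow> j < n \<Longrightarrow> (\<Sum>k<n. u i k * u j k) = (if i = j then 1 else 0)"
    and Au: "\<And>i j. i < n \<Longrightarrow> j < n \<Longrightarrow> A $$ (i,j) = (\<Sum>k<n. es ! k * u i k * u j k)"
    by (rule symmetric_real_spectral[OF A], rule that)
  define e where "e k = es ! k" for k
  have a: "a i j = (\<Sum>k<n. e k * u i k * u j k)" if "i < n" "j < n" for i j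
    using Au[OF that] that by (simp add: A_def e_def)
  have tr: "trace_power n a (2 * m) = (\<Sum>k<n. e k ^ (2 * m))"
    by (rule trace_power_spectral) (use u1 u2 a in auto)
  then show "trace_power n a (2 * m) \<ge> 0"
    by (simp add: sum_nonneg)
  assume le: "trace_power n a (2 * m) \<le> t ^ (2 * m)" and m: "m > 0" and t: "t \<ge> 0"
  have e: "\<bar>e k\<bar> \<le> t" if "k < n" for k
  proof -
    have "\<bar>e k\<bar> ^ (2 * m) = e k ^ (2 * m)" by (simp add: power_even_abs)
    also have "\<dots> \<le> (\<Sum>k<n. e k ^ (2 * m))"
      using that by (intro member_le_sum) auto
    also have "\<dots> \<le> t ^ (2 * m)" using le tr by simp
    finally show ?thesis using m t by (simp add: power_mono_iff)
  qed
  have "\<bar>\<Sum>i<n. \<Sum>j<n. a i j * y i * y j\<bar> = \<bar>\<Sum>k<n. e k * (\<Sum>i<n. u i k * y i)\<^sup>2\<bar>"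
    using quadratic_form_spectral[of n a e u y, OF a] by simp
  also have "\<dots> \<le> (\<Sum>k<n. \<bar>e k * (\<Sum>i<n. u i k * y i)\<^sup>2\<bar>)"
    by (rule sum_abs)
  also have "\<dots> \<le> (\<Sum>k<n. t * (\<Sum>i<n. u i k * y i)\<^sup>2)"
    using e by (intro sum_mono) (auto simp: abs_mult intro!: mult_right_mono)
  also have "\<dots> = t * (\<Sum>i<n. (y i)\<^sup>2)"
    using Parseval_orthonormal[of n u y, OF u2] by (simp add: sum_distrib_left[symmetric])
  finally show "\<bar>\<Sum>i<n. \<Sum>j<n. a i j * y i * y j\<bar> \<le> t * (\<Sum>i<n. (y i)\<^sup>2)" .
qed

subsection \<open>Walk expansion of matrix powers\<close>

definition walks :: "nat \<Rightarrow> nat \<Rightarrow> nat list set" where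
  "walks N n = {xs. set xs \<subseteq> {..<N} \<and> length xs = Suc n}"

text \<open>A repeated consecutive vertex contributes a singleton {x}. Such loops are kept, as they
  correspond to diagonal entries; for the centred matrix their value is 0.\<close>

fun walk_edges :: "nat list \<Rightarrow> nat set list" where
  "walk_edges (x # y # xs) = {x, y} # walk_edges (y # xs)"
| "walk_edges _ = []"

lemma length_walk_edges: "length (walk_edges xs) = length xs - 1"
  by (induction xs rule: walk_edges.induct) auto

lemma sum_walks_0: "(\<Sum>xs\<in>walks N 0. F xs) = (\<Sum>x<N. F [x])"
proof -
  have "walks N 0 = (\<lambda>x. [x]) ` {..<N}"
    by (auto simp: walks_def length_Suc_conv)
  then show ?thesis by (simp add: sum.reindex inj_on_def)
qed

lemma sum_walks_Suc: "(\<Sum>xs\<in>walks N (Suc n). F xs) = (\<Sum>ys\<in>walks N n. \<Sum>x<N. F (x # ys))"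
proof -
  have "walks N (Suc n) = (\<lambda>(ys, x). x # ys) ` (walks N n \<times> {..<N})"
    by (auto simp: walks_def length_Suc_conv image_iff)
  moreover have "inj_on (\<lambda>(ys, x). x # ys) (walks N n \<times> {..<N})"
    by (auto simp: inj_on_def)
  ultimately show ?thesis
    by (simp add: sum.reindex sum.cartesian_product case_prod_unfold)
qed

lemma walk_edges_Cons: "ys \<in> walks N n \<Longrightarrow> walk_edges (x # ys) = {x, hd ys} # walk_edges ys"
  by (cases ys) (auto simp: walks_def)

text \<open>The recursion of \<open>matrix_power\<close> multiplies on the left, just as a walk
  grows at its head: the summation index l becomes the head of the shorter walk. Writing entries as
  \<open>g {i, j}\<close> builds in symmetry.\<close>

lemma matrix_power_walks:
  assumes "i < N"
  shows "matrix_power N (\<lambda>i j. g {i, j}) n i j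
    = (\<Sum>xs\<in>walks N n. if hd xs = i \<and> last xs = j then prod_list (map g (walk_edges xs)) else 0)"
  using assms
proof (induction n arbitrary: i)
  case 0
  have "(\<Sum>x<N. if x = i \<and> x = j then 1 else 0) = (\<Sum>x<N. if x = i then (if i = j then 1 else 0) else (0::real))"
    by (intro sum.cong) auto
  then show ?case using 0 by (simp add: sum_walks_0 cong: if_cong)
next
  case (Suc n)
  have "matrix_power N (\<lambda>i j. g {i, j}) (Suc n) i j
      = (\<Sum>l<N. \<Sum>ys\<in>walks N n. if hd ys = l \<and> last ys = j then g {i, l} * prod_list (map g (walk_edges ys)) else 0)"
    using Suc.IH by (simp add: sum_distrib_left if_distrib cong: if_cong)
  also have "\<dots> = (\<Sum>ys\<in>walks N n. \<Sum>l<N. if l = hd ys then (if last ys = j then g {i, hd ys} * prod_list (map g (walk_edges ys)) else 0) else 0)"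
    by (subst sum.swap) (auto intro!: sum.cong)
  also have "\<dots> = (\<Sum>ys\<in>walks N n. if last ys = j then g {i, hd ys} * prod_list (map g (walk_edges ys)) else 0)"
  proof (intro sum.cong refl)
    fix ys assume "ys \<in> walks N n"
    then have "hd ys < N" by (cases ys) (auto simp: walks_def)
    then show "(\<Sum>l<N. if l = hd ys then (if last ys = j then g {i, hd ys} * prod_list (map g (walk_edges ys)) else 0) else 0)
      = (if last ys = j then g {i, hd ys} * prod_list (map g (walk_edges ys)) else 0)" by simp
  qed
  also have "\<dots> = (\<Sum>ys\<in>walks N n. \<Sum>x<N. if x = i then (if last ys = j then g {i, hd ys} * prod_list (map g (walk_edges ys)) else 0) else 0)"
    using Suc.prems by simp
  also have "\<dots> = (\<Sum>ys\<in>walks N n. \<Sum>x<N. if x = i \<and> last (x # ys) = j then prod_list (map g (walk_edges (x # ys))) else 0)"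
  proof (intro sum.cong refl)
    fix ys x assume ys: "ys \<in> walks N n"
    then have "ys \<noteq> []" by (auto simp: walks_def)
    then show "(if x = i then (if last ys = j then g {i, hd ys} * prod_list (map g (walk_edges ys)) else 0) else 0)
      = (if x = i \<and> last (x # ys) = j then prod_list (map g (walk_edges (x # ys))) else 0)"
      by (auto simp: walk_edges_Cons[OF ys])
  qed
  finally show ?case by (simp add: sum_walks_Suc)
qed

text \<open>For \<open>\<theta> \<ge> 1\<close> this dominates \<open>p\<close> to the number of distinct edges whenever every edge is repeated,
  which replaces the condition that all edges be repeated by a weight that can be summed step by step.\<close>
primrec edge_weight :: "real \<Rightarrow> real \<Rightarrow> 'a list \<Rightarrow> real" where
  "edge_weight p \<theta> [] = 1"
| "edge_weight p \<theta> (e # es) = (if e \<in> set es then \<theta> else p / \<theta>) * edge_weight p \<theta> es"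

lemma edge_weight_nonneg: "p \<ge> 0 \<Longrightarrow> \<theta> \<ge> 0 \<Longrightarrow> edge_weight p \<theta> es \<ge> 0"
  by (induction es) auto

text \<open>The recursion charges p / \<theta> for the occurrence of an edge nearest the end of the
  list and \<theta> for each other one. The product form shows that the order is irrelevant, so the
  weight can be compared edge by edge with independent moments.\<close>

lemma edge_weight_conv_prod:
  "edge_weight p \<theta> es = (\<Prod>e\<in>set es. p / \<theta> * \<theta> ^ (count_list es e - 1))"
proof (induction es)
  case (Cons e es)
  show ?case
  proof (cases "e \<in> set es")
    case True
    then have "count_list es e > 0" by (simp add: count_list_0_iff zero_less_iff_neq_zero)
    moreover have "(\<Prod>x\<in>set es - {e}. p / \<theta> * \<theta> ^ (count_list (e # es) x - 1))
        = (\<Prod>x\<in>set es - {e}. p / \<theta> * \<theta> ^ (count_list es x - 1))"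
      by (intro prod.cong) auto
    ultimately show ?thesis
      using True Cons by (simp add: insert_absorb prod.remove[of "set es" e] power_eq_if)
  next
    case False
    then have "(\<Prod>x\<in>set es. p / \<theta> * \<theta> ^ (count_list (e # es) x - 1))
        = (\<Prod>x\<in>set es. p / \<theta> * \<theta> ^ (count_list es x - 1))"
      by (intro prod.cong) auto
    then show ?thesis using False Cons by (simp add: count_notin)
  qed
qed simp

text \<open>Prepending a vertex multiplies the weight by \<theta> if it reuses one of the at most m
  present edges, and by p / \<theta> otherwise. Summing over all N vertices gives the same factor at
  every step; the leading N counts the walks without edges.\<close>

lemma sum_edge_weight_walks_le:
  assumes p: "p \<ge> 0" and \<theta>: "\<theta> > 0" and "n \<le> m"
  shows "(\<Sum>xs\<in>walks N n. edge_weight p \<theta> (walk_edges xs)) \<le> real N * (real N * p / \<theta> + real m * \<theta>) ^ n"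
  using \<open>n \<le> m\<close>
proof (induction n)
  case 0
  show ?case by (simp add: sum_walks_0)
next
  case (Suc n)
  let ?c = "real N * p / \<theta> + real m * \<theta>"
  have step: "(\<Sum>x<N. edge_weight p \<theta> (walk_edges (x # ys))) \<le> ?c * edge_weight p \<theta> (walk_edges ys)"
    if ys: "ys \<in> walks N n" for ys
  proof -
    let ?old = "{x \<in> {..<N}. {x, hd ys} \<in> set (walk_edges ys)}"
    \<comment> \<open>Once one endpoint \<open>hd ys\<close> is fixed, the edge determines the new
      vertex.\<close>
    have "card ?old = card ((\<lambda>x. {x, hd ys}) ` ?old)"
      by (rule card_image[symmetric]) (auto simp: inj_on_def doubleton_eq_iff)
    also have "\<dots> \<le> card (set (walk_edges ys))"
      by (intro card_mono) auto
    also have "\<dots> \<le> length (walk_edges ys)" by (rule card_length)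
    also have "\<dots> \<le> m" using ys Suc.prems by (simp add: length_walk_edges walks_def)
    finally have card: "card ?old \<le> m" .
    have "(\<Sum>x<N. if {x, hd ys} \<in> set (walk_edges ys) then \<theta> else p / \<theta>)
        \<le> (\<Sum>x<N. p / \<theta> + (if {x, hd ys} \<in> set (walk_edges ys) then \<theta> else 0))"
      using p \<theta> by (intro sum_mono) auto
    also have "\<dots> = real N * p / \<theta> + real (card ?old) * \<theta>"
      by (simp add: sum.distrib sum.If_cases Int_def)
    also have "\<dots> \<le> ?c" using card \<theta> by simp
    finally have "(\<Sum>x<N. if {x, hd ys} \<in> set (walk_edges ys) then \<theta> else p / \<theta>) * edge_weight p \<theta> (walk_edges ys)
        \<le> ?c * edge_weight p \<theta> (walk_edges ys)"
      using p \<theta> by (intro mult_right_mono edge_weight_nonneg) auto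
    then show ?thesis by (simp add: walk_edges_Cons[OF ys] sum_distrib_right)
  qed
  have "(\<Sum>xs\<in>walks N (Suc n). edge_weight p \<theta> (walk_edges xs))
      \<le> (\<Sum>ys\<in>walks N n. ?c * edge_weight p \<theta> (walk_edges ys))"
    unfolding sum_walks_Suc by (intro sum_mono step)
  also have "\<dots> \<le> ?c * (real N * ?c ^ n)"
    unfolding sum_distrib_left[symmetric] using Suc p \<theta> by (intro mult_left_mono) auto
  finally show ?case by (simp add: mult_ac)
qed

subsection \<open>Moments of the centred adjacency matrix\<close>

abbreviation edge_pmf :: "nat \<Rightarrow> real \<Rightarrow> (nat set \<Rightarrow> bool) pmf" where
  "edge_pmf N p \<equiv> Pi_pmf (possible_edges N) False (\<lambda>_. bernoulli_pmf p)"

lemma finite_possible_edges: "finite (possible_edges N)"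
  by (rule finite_subset[of _ "Pow {..<N}"]) (auto simp: possible_edges_def)

lemma finite_set_edge_pmf: "finite (set_pmf (edge_pmf N p))"
  using finite_possible_edges[of N]
  by (rule finite_subset[OF set_Pi_pmf_subset' finite_PiE_dflt]) (use finite_possible_edges in auto)

lemma integrable_edge_pmf: "integrable (edge_pmf N p) (F :: _ \<Rightarrow> real)"
  by (rule integrable_measure_pmf_finite) (rule finite_set_edge_pmf)

text \<open>The value is 0, not -p, off the possible edges. This gives the centred matrix a zero
  diagonal and annihilates walks with loops.\<close>

definition centred_edge :: "nat \<Rightarrow> real \<Rightarrow> (nat set \<Rightarrow> bool) \<Rightarrow> nat set \<Rightarrow> real" where
  "centred_edge N p f e = (if e \<in> possible_edges N then of_bool (f e) - p else 0)"

lemma prod_list_eq_prod_power_count: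
  fixes h :: "'a \<Rightarrow> real"
  assumes "finite S" "set es \<subseteq> S"
  shows "prod_list (map h es) = (\<Prod>e\<in>S. h e ^ count_list es e)"
  using assms(2)
proof (induction es)
  case (Cons e es)
  have "(\<Prod>x\<in>S. h x ^ count_list (e # es) x) = (\<Prod>x\<in>S. (if x = e then h x else 1) * h x ^ count_list es x)"
    by (intro prod.cong) auto
  also have "\<dots> = h e * (\<Prod>x\<in>S. h x ^ count_list es x)"
    using Cons.prems assms(1) by (simp add: prod.distrib)
  finally show ?case using Cons by simp
qed simp

text \<open>The first central moment vanishes. From order 2 on the absolute moment is at most the
  variance \<open>p * (1 - p)\<close>, hence at most p, and \<theta> \<ge> 1 supplies the remaining
  power.\<close>

lemma abs_bernoulli_central_moment_le:
  fixes p \<theta> :: real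
  assumes p: "0 \<le> p" "p \<le> 1" and \<theta>: "\<theta> \<ge> 1" and m: "m > 0"
  shows "\<bar>p * (1 - p) ^ m + (1 - p) * (- p) ^ m\<bar> \<le> p / \<theta> * \<theta> ^ (m - 1)"
proof (cases "m = 1")
  case True
  then show ?thesis using p \<theta> by (simp add: algebra_simps)
next
  case False
  with m have m2: "m \<ge> 2" by simp
  have "\<bar>p * (1 - p) ^ m + (1 - p) * (- p) ^ m\<bar> \<le> p * (1 - p) ^ m + (1 - p) * p ^ m"
    using p by (intro order_trans[OF abs_triangle_ineq]) (simp add: abs_mult power_abs)
  also have "\<dots> \<le> p * (1 - p)\<^sup>2 + (1 - p) * p\<^sup>2"
    using p m2 by (intro add_mono mult_left_mono power_decreasing) auto
  also have "\<dots> = p * (1 - p)" by (simp add: power2_eq_square algebra_simps)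
  also have "\<dots> \<le> p * 1" using p by (intro mult_left_mono) auto
  also have "\<dots> \<le> p * (\<theta> ^ (m - 1) / \<theta>)"
    using p m2 \<theta> self_le_power[of \<theta> "m - 1"] by (intro mult_left_mono) auto
  finally show ?thesis by simp
qed

text \<open>Grouping equal edges and using independence leaves a product of central moments, one per
  edge, of order its multiplicity. Edges off the list have order 0 and contribute 1.\<close>

lemma abs_expectation_prod_centred_edges_le:
  assumes p: "0 \<le> p" "p \<le> 1" and \<theta>: "\<theta> \<ge> 1"
  shows "\<bar>measure_pmf.expectation (edge_pmf N p) (\<lambda>f. prod_list (map (centred_edge N p f) es))\<bar>
    \<le> edge_weight p \<theta> es"
proof (cases "set es \<subseteq> possible_edges N")
  case False
  then obtain e where "e \<in> set es" "e \<notin> possible_edges N" by auto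
  then have "(\<lambda>f. prod_list (map (centred_edge N p f) es)) = (\<lambda>_. 0)"
    by (force simp: fun_eq_iff prod_list_zero_iff centred_edge_def)
  then show ?thesis using p \<theta> by (simp add: edge_weight_nonneg)
next
  case True
  let ?S = "possible_edges N"
  let ?c = "count_list es"
  have "prob_space.indep_vars (edge_pmf N p) (\<lambda>_. borel) (\<lambda>e f. (of_bool (f e) - p) ^ ?c e) ?S"
    by (rule prob_space.indep_vars_compose2[OF measure_pmf.prob_space_axioms
          indep_vars_Pi_pmf[OF finite_possible_edges]]) auto
  then have "measure_pmf.expectation (edge_pmf N p) (\<lambda>f. \<Prod>e\<in>?S. (of_bool (f e) - p) ^ ?c e)
      = (\<Prod>e\<in>?S. measure_pmf.expectation (edge_pmf N p) (\<lambda>f. (of_bool (f e) - p) ^ ?c e))"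
    by (intro prob_space.indep_vars_lebesgue_integral[OF measure_pmf.prob_space_axioms]
        finite_possible_edges integrable_edge_pmf)
  also have "\<dots> = (\<Prod>e\<in>?S. p * (1 - p) ^ ?c e + (1 - p) * (- p) ^ ?c e)"
  proof (intro prod.cong refl)
    fix e assume e: "e \<in> ?S"
    have "measure_pmf.expectation (edge_pmf N p) (\<lambda>f. (of_bool (f e) - p) ^ ?c e)
      = measure_pmf.expectation (map_pmf (\<lambda>f. f e) (edge_pmf N p)) (\<lambda>b. (of_bool b - p) ^ ?c e)"
      by simp
    also have "map_pmf (\<lambda>f. f e) (edge_pmf N p) = bernoulli_pmf p"
      using e by (simp add: Pi_pmf_component finite_possible_edges)
    finally show "measure_pmf.expectation (edge_pmf N p) (\<lambda>f. (of_bool (f e) - p) ^ ?c e)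
      = p * (1 - p) ^ ?c e + (1 - p) * (- p) ^ ?c e" using p by simp
  qed
  also have "(\<lambda>f. \<Prod>e\<in>?S. (of_bool (f e) - p) ^ ?c e) = (\<lambda>f. prod_list (map (centred_edge N p f) es))"
    by (rule ext, subst prod_list_eq_prod_power_count[OF finite_possible_edges True])
      (auto intro!: prod.cong simp: centred_edge_def)
  finally have "\<bar>measure_pmf.expectation (edge_pmf N p) (\<lambda>f. prod_list (map (centred_edge N p f) es))\<bar>
      = (\<Prod>e\<in>?S. \<bar>p * (1 - p) ^ ?c e + (1 - p) * (- p) ^ ?c e\<bar>)"
    by (simp add: abs_prod)
  also have "\<dots> = (\<Prod>e\<in>set es. \<bar>p * (1 - p) ^ ?c e + (1 - p) * (- p) ^ ?c e\<bar>)"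
    using True by (intro prod.mono_neutral_right finite_possible_edges) (auto simp: count_notin)
  also have "\<dots> \<le> (\<Prod>e\<in>set es. p / \<theta> * \<theta> ^ (?c e - 1))"
    using p \<theta> by (intro prod_mono conjI abs_bernoulli_central_moment_le)
      (auto simp: count_list_0_iff zero_less_iff_neq_zero)
  also have "\<dots> = edge_weight p \<theta> es"
    by (simp add: edge_weight_conv_prod)
  finally show ?thesis .
qed

definition centred_adjacency :: "nat \<Rightarrow> real \<Rightarrow> (nat set \<Rightarrow> bool) \<Rightarrow> nat \<Rightarrow> nat \<Rightarrow> real" where
  "centred_adjacency N p f i j = centred_edge N p f {i, j}"

lemma expectation_trace_power_le:
  assumes p: "0 \<le> p" "p \<le> 1" and \<theta>: "\<theta> \<ge> 1"
  shows "measure_pmf.expectation (edge_pmf N p) (\<lambda>f. trace_power N (centred_adjacency N p f) m)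
    \<le> real N * (real N * p / \<theta> + real m * \<theta>) ^ m"
proof -
  let ?E = "measure_pmf.expectation (edge_pmf N p)"
  have "trace_power N (centred_adjacency N p f) m = (\<Sum>xs\<in>walks N m. \<Sum>i<N.
      (if i = hd xs then of_bool (last xs = hd xs) else 0) * prod_list (map (centred_edge N p f) (walk_edges xs)))" for f
  proof -
    have "trace_power N (centred_adjacency N p f) m = (\<Sum>i<N. \<Sum>xs\<in>walks N m.
        if hd xs = i \<and> last xs = i then prod_list (map (centred_edge N p f) (walk_edges xs)) else 0)"
      by (simp add: trace_power_def centred_adjacency_def[abs_def] matrix_power_walks)
    also have "\<dots> = (\<Sum>xs\<in>walks N m. \<Sum>i<N.
        if hd xs = i \<and> last xs = i then prod_list (map (centred_edge N p f) (walk_edges xs)) else 0)"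
      by (rule sum.swap)
    finally show ?thesis by (auto intro!: sum.cong)
  qed
  moreover have "hd xs < N" if "xs \<in> walks N m" for xs
    using that by (cases xs) (auto simp: walks_def)
  ultimately have "trace_power N (centred_adjacency N p f) m = (\<Sum>xs\<in>walks N m.
      of_bool (last xs = hd xs) * prod_list (map (centred_edge N p f) (walk_edges xs)))" for f
    by (simp add: sum_distrib_right[symmetric])
  then have "?E (\<lambda>f. trace_power N (centred_adjacency N p f) m)
      = (\<Sum>xs\<in>walks N m. of_bool (last xs = hd xs) * ?E (\<lambda>f. prod_list (map (centred_edge N p f) (walk_edges xs))))"
    by (simp add: Bochner_Integration.integral_sum integrable_edge_pmf)
  \<comment> \<open>Walks that do not close may be added because all weights are nonnegative; this
    frees the sum for vertex by vertex evaluation.\<close>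
  also have "\<dots> \<le> (\<Sum>xs\<in>walks N m. edge_weight p \<theta> (walk_edges xs))"
  proof (intro sum_mono)
    fix xs
    show "of_bool (last xs = hd xs) * ?E (\<lambda>f. prod_list (map (centred_edge N p f) (walk_edges xs)))
      \<le> edge_weight p \<theta> (walk_edges xs)"
      using abs_expectation_prod_centred_edges_le[OF p \<theta>, of N "walk_edges xs"]
        edge_weight_nonneg[of p \<theta> "walk_edges xs"] p \<theta> by auto
  qed
  also have "\<dots> \<le> real N * (real N * p / \<theta> + real m * \<theta>) ^ m"
    using p \<theta> by (intro sum_edge_weight_walks_le) auto
  finally show ?thesis .
qed

text \<open>Markov's inequality with the \<theta> that makes \<open>N p / \<theta>\<close> and
  \<open>2 k \<theta>\<close> equal. The condition \<open>2 k \<le> N p\<close> says that this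
  \<theta> is at least 1. The number b is a level for the square of the spectral norm.\<close>

lemma prob_trace_power_ge:
  assumes p: "0 \<le> p" "p \<le> 1" and k: "k > 0" "2 * real k \<le> real N * p" and b: "b > 0"
  shows "measure_pmf.prob (edge_pmf N p) {f. trace_power N (centred_adjacency N p f) (2 * k) \<ge> b ^ k}
    \<le> real N * (8 * real k * (real N * p) / b) ^ k"
proof -
  define q where "q = real N * p"
  define \<theta> where "\<theta> = sqrt (q / (2 * real k))"
  have q: "q > 0" using k by (simp add: q_def)
  have \<theta>: "\<theta> \<ge> 1" using k by (simp add: \<theta>_def q_def)
  have \<theta>2: "\<theta>\<^sup>2 = q / (2 * real k)" using q k by (simp add: \<theta>_def)
  have "q = 2 * real k * \<theta>\<^sup>2" using k by (simp add: \<theta>2)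
  then have "q / \<theta> = 2 * real k * \<theta>" using \<theta> by (simp add: power2_eq_square divide_simps)
  then have "(q / \<theta> + real (2 * k) * \<theta>)\<^sup>2 = 16 * (real k)\<^sup>2 * \<theta>\<^sup>2"
    by (simp add: power2_eq_square algebra_simps)
  also have "\<dots> = 8 * real k * q"
    unfolding \<theta>2 using k by (simp add: power2_eq_square)
  finally have sq: "(q / \<theta> + real (2 * k) * \<theta>)\<^sup>2 = 8 * real k * q" .
  have "measure_pmf.prob (edge_pmf N p) {f \<in> space (edge_pmf N p). trace_power N (centred_adjacency N p f) (2 * k) \<ge> b ^ k}
    \<le> measure_pmf.expectation (edge_pmf N p) (\<lambda>f. trace_power N (centred_adjacency N p f) (2 * k)) / b ^ k"
  proof (rule integral_Markov_inequality_measure[where A = "{}", OF integrable_edge_pmf])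
    show "AE f in edge_pmf N p. 0 \<le> trace_power N (centred_adjacency N p f) (2 * k)"
      by (intro AE_I2 trace_power_even_nonneg) (simp add: centred_adjacency_def insert_commute)
  qed (use b in auto)
  also have "\<dots> \<le> real N * (q / \<theta> + real (2 * k) * \<theta>) ^ (2 * k) / b ^ k"
    using expectation_trace_power_le[OF p \<theta>, of N "2 * k"] b by (intro divide_right_mono) (auto simp: q_def)
  also have "\<dots> = real N * (8 * real k * q / b) ^ k"
    unfolding power_mult sq by (simp add: power_divide)
  finally show ?thesis by (simp add: q_def)
qed

section \<open>Lower tail of the vertex degrees\<close>

definition vertex_degree :: "nat \<Rightarrow> (nat set \<Rightarrow> bool) \<Rightarrow> nat \<Rightarrow> nat" where
  "vertex_degree N f i = card {e \<in> possible_edges N. f e \<and> i \<in> e}"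

lemma card_possible_edges_at:
  assumes "i < N"
  shows "card {e \<in> possible_edges N. i \<in> e} = N - 1"
proof -
  have "{e \<in> possible_edges N. i \<in> e} = (\<lambda>j. {i, j}) ` ({..<N} - {i})"
  proof (intro equalityI subsetI)
    fix e assume "e \<in> {e \<in> possible_edges N. i \<in> e}"
    then have e: "e \<subseteq> {..<N}" "card e = 2" "i \<in> e" by (auto simp: possible_edges_def)
    then obtain x y where "e = {x, y}" "x \<noteq> y" by (auto simp: card_2_iff)
    then show "e \<in> (\<lambda>j. {i, j}) ` ({..<N} - {i})" using e by auto
  qed (use assms in \<open>auto simp: possible_edges_def\<close>)
  moreover have "inj_on (\<lambda>j. {i, j}) ({..<N} - {i})"
    by (auto simp: inj_on_def doubleton_eq_iff)
  ultimately show ?thesis using assms by (simp add: card_image)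
qed

lemma prob_vertex_degree_le:
  assumes p: "0 \<le> p" "p \<le> 1" and i: "i < N" and \<delta>: "0 \<le> \<delta>"
  shows "measure_pmf.prob (edge_pmf N p) {f. real (vertex_degree N f i) \<le> (1 - \<delta>) * (real (N - 1) * p)}
    \<le> exp (- (\<delta>\<^sup>2 / 2) * (real (N - 1) * p))"
proof -
  define \<mu> where "\<mu> = real (N - 1) * p"
  have \<mu>: "\<mu> \<ge> 0" using p by (simp add: \<mu>_def)
  let ?S = "possible_edges N"
  let ?w = "\<lambda>e b. if i \<in> e \<and> b then exp (- \<delta>) else (1::real)"
  have w: "exp (- \<delta> * real (vertex_degree N f i)) = (\<Prod>e\<in>?S. ?w e (f e))" for f
  proof -
    have "(\<Prod>e\<in>?S. ?w e (f e)) = exp (- \<delta>) ^ card {e \<in> ?S. i \<in> e \<and> f e}"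
      by (simp add: prod.If_cases finite_possible_edges Int_def)
    also have "{e \<in> ?S. i \<in> e \<and> f e} = {e \<in> ?S. f e \<and> i \<in> e}" by auto
    finally show ?thesis by (simp add: vertex_degree_def exp_of_nat_mult[symmetric] mult_ac)
  qed
  have "measure_pmf.expectation (edge_pmf N p) (\<lambda>f. exp (- \<delta> * real (vertex_degree N f i)))
      = (\<Prod>e\<in>?S. measure_pmf.expectation (bernoulli_pmf p) (?w e))"
    unfolding w by (intro expectation_prod_Pi_pmf finite_possible_edges integrable_measure_pmf_finite) auto
  also have "\<dots> = (\<Prod>e\<in>?S. if i \<in> e then 1 - p * (1 - exp (- \<delta>)) else 1)"
    using p by (intro prod.cong) (auto simp: algebra_simps)
  also have "\<dots> = (1 - p * (1 - exp (- \<delta>))) ^ card {e \<in> ?S. i \<in> e}"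
    by (simp add: prod.If_cases finite_possible_edges Int_def)
  also have "\<dots> = (1 - p * (1 - exp (- \<delta>))) ^ (N - 1)"
    by (simp add: card_possible_edges_at i)
  also have "\<dots> \<le> exp (- (p * (1 - exp (- \<delta>)))) ^ (N - 1)"
  proof (rule power_mono)
    show "1 - p * (1 - exp (- \<delta>)) \<le> exp (- (p * (1 - exp (- \<delta>))))"
      using exp_ge_add_one_self[of "- (p * (1 - exp (- \<delta>)))"] by simp
    show "0 \<le> 1 - p * (1 - exp (- \<delta>))"
      using p \<delta> mult_le_one[of p "1 - exp (- \<delta>)"] by simp
  qed
  also have "\<dots> = exp (- (\<mu> * (1 - exp (- \<delta>))))"
    by (simp add: \<mu>_def exp_of_nat_mult[symmetric] mult_ac)
  finally have E: "measure_pmf.expectation (edge_pmf N p) (\<lambda>f. exp (- \<delta> * real (vertex_degree N f i)))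
      \<le> exp (- (\<mu> * (1 - exp (- \<delta>))))" .
  have "measure_pmf.prob (edge_pmf N p) {f. real (vertex_degree N f i) \<le> (1 - \<delta>) * \<mu>}
    \<le> measure_pmf.prob (edge_pmf N p) {f \<in> space (edge_pmf N p).
        exp (- \<delta> * real (vertex_degree N f i)) \<ge> exp (- \<delta> * ((1 - \<delta>) * \<mu>))}"
    using \<delta> by (intro measure_pmf.finite_measure_mono) (auto intro!: mult_left_mono)
  also have "\<dots> \<le> measure_pmf.expectation (edge_pmf N p) (\<lambda>f. exp (- \<delta> * real (vertex_degree N f i)))
      / exp (- \<delta> * ((1 - \<delta>) * \<mu>))"
    by (rule integral_Markov_inequality_measure[OF integrable_edge_pmf]) auto
  also have "\<dots> \<le> exp (- (\<mu> * (1 - exp (- \<delta>)))) / exp (- \<delta> * ((1 - \<delta>) * \<mu>))"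
    by (intro divide_right_mono E) simp
  also have "\<dots> = exp (\<mu> * (\<delta> * (1 - \<delta>) - (1 - exp (- \<delta>))))"
    by (simp add: exp_diff[symmetric] algebra_simps)
  also have "\<dots> \<le> exp (\<mu> * (- (\<delta>\<^sup>2 / 2)))"
  proof -
    \<comment> \<open>The product of the quadratic Taylor polynomials at \<delta> and -\<delta> is 1
      + \<delta>^4 / 4, so the known lower bound for \<open>exp \<delta>\<close> turns into this
      upper bound.\<close>
    have "exp (- \<delta>) \<le> 1 - \<delta> + \<delta>\<^sup>2 / 2"
    proof -
      have "1 \<le> 1 + \<delta> ^ 4 / 4" by simp
      also have "\<dots> = (1 - \<delta> + \<delta>\<^sup>2 / 2) * (1 + \<delta> + \<delta>\<^sup>2 / 2)"
        by (simp add: algebra_simps power2_eq_square power4_eq_xxxx)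
      also have "\<dots> \<le> (1 - \<delta> + \<delta>\<^sup>2 / 2) * exp \<delta>"
      proof (rule mult_left_mono)
        show "1 + \<delta> + \<delta>\<^sup>2 / 2 \<le> exp \<delta>"
          using \<delta> by (rule exp_lower_Taylor_quadratic)
        show "0 \<le> 1 - \<delta> + \<delta>\<^sup>2 / 2"
          using zero_le_power2[of "1 - \<delta>"] unfolding power2_diff by simp
      qed
      finally show ?thesis by (simp add: exp_minus field_simps)
    qed
    then have "\<delta> * (1 - \<delta>) - (1 - exp (- \<delta>)) \<le> - (\<delta>\<^sup>2 / 2)"
      by (simp add: power2_eq_square algebra_simps)
    then show ?thesis
      unfolding exp_le_cancel_iff using \<mu> by (rule mult_left_mono)
  qed
  finally show ?thesis by (simp add: \<mu>_def mult_ac)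
qed

subsection \<open>The spectral gap of the propagation matrix\<close>

lemma num_components_bounds:
  assumes "N > 0"
  shows "1 \<le> num_components N E" "num_components N E \<le> N"
proof -
  let ?r = "{(u, v). {u, v} \<in> E}\<^sup>* \<inter> {..<N} \<times> {..<N}"
  have img: "{..<N} // ?r = (\<lambda>x. ?r `` {x}) ` {..<N}" by (auto simp: quotient_def)
  show "num_components N E \<le> N"
    unfolding num_components_def img using card_image_le[of "{..<N}" "\<lambda>x. ?r `` {x}"] by simp
  have "card ({..<N} // ?r) \<noteq> 0"
    unfolding img using assms by auto
  then show "1 \<le> num_components N E" by (simp add: num_components_def)
qed

lemma graph_lambda_nonneg:
  assumes "N > 0"
  shows "graph_lambda N E \<ge> 0"
proof (cases "num_components N E = N")
  case False
  then have "0 \<in> {..<N - num_components N E}"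
    using num_components_bounds[OF assms, of E] by auto
  then have "\<bar>sorted_eigenvalues (propagation_matrix N E) ! 0\<bar> \<le> graph_lambda N E"
    using False by (auto simp: graph_lambda_def Let_def intro!: Max_ge)
  then show ?thesis by linarith
qed (simp add: graph_lambda_def)

text \<open>Since there is at least one component, only the top eigenvalue has to be discarded; connectedness plays no role.\<close>
lemma graph_lambda_le:
  assumes "N > 0" "\<tau> \<ge> 0"
    and "\<And>n. Suc n < N \<Longrightarrow> \<bar>sorted_eigenvalues (propagation_matrix N E) ! n\<bar> \<le> \<tau>"
  shows "graph_lambda N E \<le> \<tau>"
proof (cases "num_components N E = N")
  case False
  then have "0 \<in> {..<N - num_components N E}"
    using num_components_bounds[OF assms(1), of E] by auto
  then have "{..<N - num_components N E} \<noteq> {}" by blast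
  then show ?thesis
    using False num_components_bounds[OF assms(1), of E] assms(3)
    by (auto simp: graph_lambda_def Let_def)
qed (use assms in \<open>simp add: graph_lambda_def\<close>)

definition edge_set :: "nat \<Rightarrow> (nat set \<Rightarrow> bool) \<Rightarrow> nat set set" where
  "edge_set N f = {e \<in> possible_edges N. f e}"

lemma gnp_conv_edge_set: "gnp N p = map_pmf (edge_set N) (edge_pmf N p)"
  by (simp add: gnp_def edge_set_def[abs_def])

lemma propagation_matrix_entry:
  assumes "i < N" "j < N"
  shows "propagation_matrix N (edge_set N f) $$ (i, j)
    = (if i = j then 1 else of_bool ({i, j} \<in> edge_set N f))
      / sqrt (1 + real (vertex_degree N f i)) / sqrt (1 + real (vertex_degree N f j))"
proof -
  define D where "D = diag_inv_sqrt (augmented_degree N (edge_set N f))"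
  define A where "A = augmented_adjacency N (edge_set N f)"
  define d where "d i = 1 / sqrt (1 + real (vertex_degree N f i))" for i
  have D: "D \<in> carrier_mat N N" and A: "A \<in> carrier_mat N N"
    by (simp_all add: D_def A_def diag_inv_sqrt_def augmented_degree_def degree_matrix_def
        augmented_adjacency_def adjacency_matrix_def)
  have deg: "card {e \<in> edge_set N f. i \<in> e} = vertex_degree N f i" for i
    by (simp add: edge_set_def vertex_degree_def conj_assoc)
  have D_entry: "D $$ (i, j) = (if i = j then d i else 0)" if "i < N" "j < N" for i j
    using that by (simp add: D_def diag_inv_sqrt_def augmented_degree_def degree_matrix_def d_def deg add.commute)
  have "{i} \<notin> edge_set N f" for i by (simp add: edge_set_def possible_edges_def)
  then have A_entry: "A $$ (i, j) = (if i = j then 1 else of_bool ({i, j} \<in> edge_set N f))" if "i < N" "j < N" for i j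
    using that by (auto simp: A_def augmented_adjacency_def adjacency_matrix_def)
  have DA: "(D * A) $$ (i, k) = d i * A $$ (i, k)" if "k < N" for k
  proof -
    have "(D * A) $$ (i, k) = (\<Sum>l<N. D $$ (i, l) * A $$ (l, k))"
      using assms that D A by (simp add: scalar_prod_def lessThan_atLeast0)
    also have "\<dots> = (\<Sum>l<N. if l = i then d i * A $$ (i, k) else 0)"
      using assms by (intro sum.cong) (auto simp: D_entry)
    finally show ?thesis using assms by simp
  qed
  have "(X * D) $$ (i, j) = (\<Sum>k<N. X $$ (i, k) * D $$ (k, j))" if "X \<in> carrier_mat N N" for X
    using assms that D by (simp add: scalar_prod_def lessThan_atLeast0)
  from this[of "D * A"] have "(D * A * D) $$ (i, j) = (\<Sum>k<N. (D * A) $$ (i, k) * D $$ (k, j))"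
    using D A by simp
  also have "\<dots> = (\<Sum>k<N. if k = j then d i * A $$ (i, j) * d j else 0)"
    using assms by (intro sum.cong) (auto simp: D_entry DA)
  also have "\<dots> = d i * A $$ (i, j) * d j" using assms by simp
  finally show ?thesis using assms
    by (simp add: propagation_matrix_def D_def[symmetric] A_def[symmetric] A_entry d_def)
qed

lemma propagation_matrix_carrier: "propagation_matrix N E \<in> carrier_mat N N"
  unfolding propagation_matrix_def
  by (intro mult_carrier_mat[of _ N N]) (simp_all add: diag_inv_sqrt_def augmented_degree_def
      degree_matrix_def augmented_adjacency_def adjacency_matrix_def)

text \<open>Conjugating \<^term>\<open>p\<close> times the all-ones matrix by the inverse square roots of the degrees gives a
  rank one form, which is removed by \<open>sorted_eigenvalues_rank_one_perturbation\<close>.\<close>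
lemma graph_lambda_le_centred_adjacency:
  fixes m p t :: real
  assumes N: "N > 0" and p: "0 \<le> p" "p \<le> 1" and m: "m > 0" and t: "t \<ge> 0"
    and deg: "\<And>i. i < N \<Longrightarrow> m \<le> 1 + real (vertex_degree N f i)"
    and form: "\<And>y. \<bar>\<Sum>i<N. \<Sum>j<N. centred_adjacency N p f i j * y i * y j\<bar> \<le> t * (\<Sum>i<N. (y i)\<^sup>2)"
  shows "graph_lambda N (edge_set N f) \<le> (t + 1) / m"
proof (rule graph_lambda_le[OF N])
  show "0 \<le> (t + 1) / m" using t m by simp
  fix n assume n: "Suc n < N"
  let ?P = "propagation_matrix N (edge_set N f)"
  define d where "d i = 1 / sqrt (1 + real (vertex_degree N f i))" for i
  \<comment> \<open>On the diagonal the augmented adjacency has 1 and the centred one 0, so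
    subtracting p leaves 1 - p. This correction is the source of the 1 in
    \<open>t + 1\<close>.\<close>
  have entry: "?P $$ (i, j) = d i * d j * ((centred_adjacency N p f i j + (if i = j then 1 - p else 0)) + p)"
    if "i < N" "j < N" for i j
  proof -
    have "i \<noteq> j \<Longrightarrow> {i, j} \<in> possible_edges N" using that by (simp add: possible_edges_def)
    moreover have "{i} \<notin> possible_edges N" by (simp add: possible_edges_def)
    ultimately show ?thesis
      unfolding propagation_matrix_entry[OF that]
      by (auto simp: d_def centred_adjacency_def centred_edge_def edge_set_def)
  qed
  show "\<bar>sorted_eigenvalues ?P ! n\<bar> \<le> (t + 1) / m"
  proof (rule sorted_eigenvalues_rank_one_perturbation[OF propagation_matrix_carrier _ _ n])
    show "transpose_mat ?P = ?P"
    proof (rule eq_matI)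
      fix i j assume "i < dim_row ?P" "j < dim_col ?P"
      then have "i < N" "j < N" using propagation_matrix_carrier[of N "edge_set N f"] by auto
      then show "transpose_mat ?P $$ (i, j) = ?P $$ (i, j)"
        using propagation_matrix_carrier[of N "edge_set N f"]
        by (simp add: propagation_matrix_entry insert_commute mult.commute)
    qed (use propagation_matrix_carrier[of N "edge_set N f"] in auto)
    fix y :: "nat \<Rightarrow> real"
    define z where "z i = d i * y i" for i
    let ?X = "\<Sum>i<N. \<Sum>j<N. centred_adjacency N p f i j * z i * z j"
    have "(\<Sum>i<N. \<Sum>j<N. ?P $$ (i, j) * y i * y j) = (\<Sum>i<N. \<Sum>j<N. centred_adjacency N p f i j * z i * z j
        + (if j = i then (1 - p) * (z i)\<^sup>2 else 0) + p * (z i * z j))"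
      by (intro sum.cong refl) (simp add: entry z_def power2_eq_square algebra_simps)
    also have "\<dots> = ?X + (1 - p) * (\<Sum>i<N. (z i)\<^sup>2) + p * (\<Sum>i<N. z i)\<^sup>2"
      unfolding power2_eq_square sum_product by (simp add: sum.distrib sum_distrib_left)
    finally have "(\<Sum>i<N. \<Sum>j<N. ?P $$ (i, j) * y i * y j) = \<dots>" .
    moreover have "(\<Sum>i<N. (sqrt p * d i) * y i)\<^sup>2 = p * (\<Sum>i<N. z i)\<^sup>2"
      using p by (simp add: z_def sum_distrib_left[symmetric] mult.assoc power_mult_distrib)
    ultimately have "\<bar>(\<Sum>i<N. \<Sum>j<N. ?P $$ (i, j) * y i * y j) - (\<Sum>i<N. (sqrt p * d i) * y i)\<^sup>2\<bar>
      = \<bar>?X + (1 - p) * (\<Sum>i<N. (z i)\<^sup>2)\<bar>" by simp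
    also have "\<dots> \<le> \<bar>?X\<bar> + (1 - p) * (\<Sum>i<N. (z i)\<^sup>2)"
      using p by (intro order_trans[OF abs_triangle_ineq]) (simp add: sum_nonneg)
    also have "\<dots> \<le> t * (\<Sum>i<N. (z i)\<^sup>2) + 1 * (\<Sum>i<N. (z i)\<^sup>2)"
      using p form[of z] by (intro add_mono mult_right_mono) (auto simp: sum_nonneg)
    also have "\<dots> = (t + 1) * (\<Sum>i<N. (z i)\<^sup>2)" by (simp add: algebra_simps)
    also have "\<dots> \<le> (t + 1) * (\<Sum>i<N. 1 / m * (y i)\<^sup>2)"
    proof (intro mult_left_mono sum_mono)
      fix i assume "i \<in> {..<N}"
      then have "(d i)\<^sup>2 \<le> 1 / m"
        using deg[of i] m by (auto simp: d_def power_divide intro!: divide_left_mono)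
      then show "(z i)\<^sup>2 \<le> 1 / m * (y i)\<^sup>2"
        unfolding z_def power_mult_distrib by (intro mult_right_mono) auto
    qed (use t in simp)
    also have "\<dots> = (t + 1) / m * (\<Sum>i<N. (y i)\<^sup>2)"
      by (simp add: sum_distrib_left[symmetric] sum_divide_distrib[symmetric])
    finally show "\<bar>(\<Sum>i<N. \<Sum>j<N. ?P $$ (i, j) * y i * y j) - (\<Sum>i<N. (sqrt p * d i) * y i)\<^sup>2\<bar>
      \<le> (t + 1) / m * (\<Sum>i<N. (y i)\<^sup>2)" .
  qed
qed

text \<open>Outside one trace event and N low-degree events the deterministic bound applies with t =
  \<open>sqrt b\<close>. Relative degree loss 1/7 gives both the factor 6/7 and the exponent (1/7)^2
  / 2 = 1/98; the added self-loop covers the 1 in \<Delta>.\<close>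

lemma prob_graph_lambda_gt:
  assumes p: "0 \<le> p" "p \<le> 1" and N: "N > 0"
    and k: "k > 0" "2 * real k \<le> real N * p" and b: "b > 0"
  defines "\<Delta> \<equiv> real N * p - p + 1"
  shows "measure_pmf.prob (gnp N p) {E. \<not> graph_lambda N E \<le> (sqrt b + 1) / (6 / 7 * \<Delta>)}
    \<le> real N * (8 * real k * (real N * p) / b) ^ k + real N * exp (- (1 / 98) * (real N * p - p))"
proof -
  let ?M = "edge_pmf N p"
  have \<Delta>': "real (N - 1) * p = real N * p - p" using N by (simp add: of_nat_diff algebra_simps)
  have "real (N - 1) * p \<ge> 0" using p by simp
  then have \<Delta>: "\<Delta> > 0" unfolding \<Delta>' \<Delta>_def by simp
  define T where "T = {f. trace_power N (centred_adjacency N p f) (2 * k) \<ge> b ^ k}"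
  define L where "L i = {f. real (vertex_degree N f i) \<le> (1 - 1 / 7) * (real (N - 1) * p)}" for i
  have "edge_set N -` {E. \<not> graph_lambda N E \<le> (sqrt b + 1) / (6 / 7 * \<Delta>)} \<subseteq> T \<union> (\<Union>i<N. L i)"
  proof
    fix f assume f: "f \<in> edge_set N -` {E. \<not> graph_lambda N E \<le> (sqrt b + 1) / (6 / 7 * \<Delta>)}"
    show "f \<in> T \<union> (\<Union>i<N. L i)"
    proof (rule ccontr)
      assume "f \<notin> T \<union> (\<Union>i<N. L i)"
      then have T: "trace_power N (centred_adjacency N p f) (2 * k) \<le> b ^ k"
        and L: "\<And>i. i < N \<Longrightarrow> 6 / 7 * (real (N - 1) * p) \<le> real (vertex_degree N f i)"
        by (auto simp: T_def L_def not_le intro: less_imp_le)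
      have "graph_lambda N (edge_set N f) \<le> (sqrt b + 1) / (6 / 7 * \<Delta>)"
      proof (rule graph_lambda_le_centred_adjacency[OF N p])
        show "6 / 7 * \<Delta> \<le> 1 + real (vertex_degree N f i)" if "i < N" for i
          using L[OF that] unfolding \<Delta>' \<Delta>_def by (simp add: algebra_simps)
        show "\<bar>\<Sum>i<N. \<Sum>j<N. centred_adjacency N p f i j * y i * y j\<bar> \<le> sqrt b * (\<Sum>i<N. (y i)\<^sup>2)" for y
        proof (rule quadratic_form_le_trace_power[where m = k])
          have "sqrt b ^ (2 * k) = b ^ k" using b by (simp add: power_mult)
          then show "trace_power N (centred_adjacency N p f) (2 * k) \<le> sqrt b ^ (2 * k)" using T by simp
        qed (use k b in \<open>auto simp: centred_adjacency_def insert_commute\<close>)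
      qed (use \<Delta> b in auto)
      then show False using f by simp
    qed
  qed
  then have "measure_pmf.prob (gnp N p) {E. \<not> graph_lambda N E \<le> (sqrt b + 1) / (6 / 7 * \<Delta>)}
      \<le> measure_pmf.prob ?M (T \<union> (\<Union>i<N. L i))"
    unfolding gnp_conv_edge_set measure_map_pmf by (intro measure_pmf.finite_measure_mono) auto
  also have "\<dots> \<le> measure_pmf.prob ?M T + measure_pmf.prob ?M (\<Union>i<N. L i)"
    by (rule measure_Un_le) auto
  also have "measure_pmf.prob ?M (\<Union>i<N. L i) \<le> (\<Sum>i<N. measure_pmf.prob ?M (L i))"
    by (rule measure_UNION_le) auto
  also have "\<dots> \<le> (\<Sum>i<N. exp (- (1 / 98) * (real N * p - p)))"
  proof (rule sum_mono)
    fix i assume "i \<in> {..<N}"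
    then show "measure_pmf.prob ?M (L i) \<le> exp (- (1 / 98) * (real N * p - p))"
      using prob_vertex_degree_le[OF p, of i N "1 / 7"] unfolding L_def \<Delta>'
      by (simp add: power2_eq_square)
  qed
  also have "measure_pmf.prob ?M T \<le> real N * (8 * real k * (real N * p) / b) ^ k"
    unfolding T_def by (rule prob_trace_power_ge[OF p k b])
  finally show ?thesis by simp
qed

section \<open>Choice of constants and conclusion\<close>

lemma ereal_mult_less_one:
  fixes S :: ereal and r l t :: real
  assumes "S < ereal r" "0 \<le> l" "l \<le> t" "r * t = 1"
  shows "S * ereal l < 1"
proof (cases "l = 0")
  case False
  then have l: "l > 0" using assms by simp
  have "r > 0" using assms l by (simp add: zero_less_mult_pos2[of r t])
  then have rl: "r * l \<le> 1" using assms mult_left_mono[of l t r] by simp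
  \<comment> \<open>Since l > 0, strictness is inherited from \<open>S < r\<close>. A bound from
    above leaves S = -\<infinity> possible, where the product is -\<infinity> as well.\<close>
  show ?thesis
  proof (cases S)
    case (real s)
    then have "s * l < r * l" using assms l by (intro mult_strict_right_mono) auto
    then show ?thesis using real rl by (simp flip: one_ereal_def)
  qed (use assms l in auto)
qed (simp add: zero_ereal_def[symmetric])

text \<open>The assumptions on N are quantitative forms of what holds eventually. Those with
  exponentials say that 4 N^(-1/3) and N^(-49), the bounds for the trace and degree events, are at
  most \<epsilon> / 2.\<close>

lemma prob_graph_lambda_le:
  assumes p: "0 \<le> p" "p \<le> 1" and \<epsilon>: "0 < \<epsilon>" "\<epsilon> < 1" and N: "N \<ge> 2" and lnN: "ln (real N) \<ge> 1"
    and Np: "10000 * ln (real N) \<le> real N * p"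
    and e1: "4 * real N * exp (- (4 / 3) * ln (real N)) \<le> \<epsilon> / 2"
    and e2: "real N * exp (- 50 * ln (real N)) \<le> \<epsilon> / 2"
  defines "\<Delta> \<equiv> real N * p - p + 1"
  shows "measure_pmf.prob (gnp N p) {E. graph_lambda N E \<le> 7 * sqrt (ln (4 * real N / \<epsilon>) / \<Delta>)} \<ge> 1 - \<epsilon>"
proof -
  define q where "q = real N * p"
  define L where "L = ln (4 * real N / \<epsilon>)"
  define k where "k = nat \<lfloor>ln (real N)\<rfloor>"
  \<comment> \<open>The factor 32 makes the base \<open>8 k q / b\<close> at most 1/4. Its power
    then decays like N to the exponent \<open>- ln 4\<close>, which beats the factor N; rounding k
    down costs only a factor 4.\<close>
  define b where "b = 32 * q * ln (real N)"
  define \<tau> where "\<tau> = (sqrt b + 1) / (6 / 7 * \<Delta>)"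
  have q: "q \<ge> 10000 * ln (real N)" "q \<ge> 10000" using Np lnN by (simp_all add: q_def)
  have \<Delta>: "q \<le> \<Delta>" using p by (simp add: q_def \<Delta>_def)
  have "real N \<le> 4 * real N / \<epsilon>" using N \<epsilon> by (simp add: field_simps)
  then have L: "ln (real N) \<le> L" using N unfolding L_def by (subst ln_le_cancel_iff) auto
  have k: "k \<ge> 1" "real k \<le> ln (real N)" "ln (real N) - 1 \<le> real k"
    using lnN by (simp_all add: k_def le_nat_iff)
  have b: "b > 0" using q lnN by (simp add: b_def)
  have "measure_pmf.prob (gnp N p) {E. \<not> graph_lambda N E \<le> \<tau>}
      \<le> real N * (8 * real k * q / b) ^ k + real N * exp (- (1 / 98) * (q - p))"
    unfolding \<tau>_def \<Delta>_def q_def using p N k b q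
    by (intro prob_graph_lambda_gt) (auto simp: q_def)
  also have "real N * (8 * real k * q / b) ^ k \<le> \<epsilon> / 2"
  proof -
    have "8 * real k * q / b = real k / (4 * ln (real N))" using q by (simp add: b_def)
    also have "\<dots> \<le> 1 / 4" using k lnN by (simp add: field_simps)
    finally have "(8 * real k * q / b) ^ k \<le> (1 / 4) ^ k"
      using q b by (intro power_mono) auto
    also have "\<dots> = (1 / 4) powr real k" by (simp add: powr_realpow)
    also have "\<dots> \<le> (1 / 4) powr (ln (real N) - 1)" using k by (intro powr_mono') auto
    also have "\<dots> = 4 * (1 / 4) powr ln (real N)" by (simp add: powr_diff)
    also have "\<dots> = 4 * exp (- ln 4 * ln (real N))" by (simp add: powr_def ln_div)
    also have "\<dots> \<le> 4 * exp (- (4 / 3) * ln (real N))"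
    proof -
      have "ln 4 = 2 * ln (2 :: real)" using ln_realpow[of 2 2] by simp
      then have "4 / 3 \<le> ln (4 :: real)" using ln2_ge_two_thirds by simp
      then have "- ln 4 * ln (real N) \<le> - (4 / 3) * ln (real N)"
        using lnN by (intro mult_right_mono) auto
      then show ?thesis by simp
    qed
    finally have "real N * (8 * real k * q / b) ^ k \<le> real N * (4 * exp (- (4 / 3) * ln (real N)))"
      by (intro mult_left_mono) auto
    then show ?thesis using e1 by simp
  qed
  also have "real N * exp (- (1 / 98) * (q - p)) \<le> \<epsilon> / 2"
  proof -
    \<comment> \<open>Thus p takes at most half of q, leaving well over 4900 \<open>ln N\<close> =
      98 * 50 \<open>ln N\<close>.\<close>
    have "2 * p \<le> q" unfolding q_def using N p by (intro mult_right_mono) auto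
    then have "4900 * ln (real N) \<le> q - p" using q lnN by linarith
    then have "- (1 / 98) * (q - p) \<le> - 50 * ln (real N)" by simp
    then have "real N * exp (- (1 / 98) * (q - p)) \<le> real N * exp (- 50 * ln (real N))"
      by (intro mult_left_mono) auto
    then show ?thesis using e2 by simp
  qed
  finally have bad: "measure_pmf.prob (gnp N p) {E. \<not> graph_lambda N E \<le> \<tau>} \<le> \<epsilon>" by simp
  have "\<tau> \<le> 7 * sqrt (L / \<Delta>)"
  proof -
    \<comment> \<open>In this unit, \<open>sqrt b\<close> is at most \<open>sqrt 32 * w\<close>,
      below 5.7 w. As w \<ge> 4, the added 1 fits into 0.3 w, and 6 divided by 6/7 is the constant
      7.\<close>
    define w where "w = sqrt (L * \<Delta>)"
    have "1 * 10000 \<le> L * \<Delta>" using L lnN q \<Delta> by (intro mult_mono) auto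
    then have w: "w \<ge> 4" unfolding w_def by (intro real_le_rsqrt) auto
    have w2: "w\<^sup>2 = L * \<Delta>" using L lnN q \<Delta> by (simp add: w_def)
    have "ln (real N) * q \<le> L * \<Delta>" using L lnN q \<Delta> by (intro mult_mono) auto
    then have "b \<le> 32 * w\<^sup>2" unfolding b_def w2 by (simp add: mult.commute)
    also have "\<dots> \<le> (57 / 10 * w)\<^sup>2" by (simp add: power_mult_distrib power2_eq_square)
    finally have "sqrt b \<le> 57 / 10 * w" using w by (intro real_le_lsqrt) auto
    then have "sqrt b + 1 \<le> 6 * w" using w by simp
    then have "\<tau> \<le> 6 * w / (6 / 7 * \<Delta>)" unfolding \<tau>_def using q \<Delta> by (intro divide_right_mono) auto
    also have "\<dots> = 7 * (w / \<Delta>)" by simp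
    also have "w / \<Delta> = sqrt (L / \<Delta>)"
    proof (rule real_sqrt_unique[symmetric])
      show "(w / \<Delta>)\<^sup>2 = L / \<Delta>" using q \<Delta> unfolding power_divide w2 by (simp add: power2_eq_square)
      show "0 \<le> w / \<Delta>" using w q \<Delta> by simp
    qed
    finally show ?thesis .
  qed
  then have "measure_pmf.prob (gnp N p) {E. graph_lambda N E \<le> \<tau>}
      \<le> measure_pmf.prob (gnp N p) {E. graph_lambda N E \<le> 7 * sqrt (L / \<Delta>)}"
    by (intro measure_pmf.finite_measure_mono) auto
  moreover have "{E. \<not> graph_lambda N E \<le> \<tau>} = UNIV - {E. graph_lambda N E \<le> \<tau>}" by auto
  ultimately show ?thesis
    using bad measure_pmf.prob_compl[of "{E. graph_lambda N E \<le> \<tau>}" "gnp N p"] by (simp add: L_def)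
qed

theorem theorem3:
  fixes p :: "nat \<Rightarrow> real"
  assumes "\<And>N. 0 \<le> p N \<and> p N \<le> 1"
    and "\<forall>\<^sub>F N in sequentially. 0 < p N"
    and "(\<lambda>N. ln (real N) / (real N * p N)) \<in> o(\<lambda>_. 1)"
  shows "\<forall>\<epsilon>::real. \<epsilon> > 0 \<longrightarrow>
    (\<forall>\<^sub>F N in sequentially. \<forall>(C::nat) (W :: nat \<Rightarrow> real mat).
       C \<ge> 1 \<longrightarrow> (\<forall>l\<ge>1. W l \<in> carrier_mat C C) \<longrightarrow>
       sup_singular_value W
         < ereal (1 / 7 * sqrt ((real N * p N - p N + 1) / ln (4 * real N / \<epsilon>))) \<longrightarrow>
       measure_pmf.prob (gnp N (p N))
         {E. sup_singular_value W * ereal (graph_lambda N E) < 1} \<ge> 1 - \<epsilon>)"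
proof (intro allI impI)
  fix \<epsilon> :: real assume \<epsilon>: "\<epsilon> > 0"
  show "\<forall>\<^sub>F N in sequentially. \<forall>(C::nat) (W :: nat \<Rightarrow> real mat).
       C \<ge> 1 \<longrightarrow> (\<forall>l\<ge>1. W l \<in> carrier_mat C C) \<longrightarrow>
       sup_singular_value W
         < ereal (1 / 7 * sqrt ((real N * p N - p N + 1) / ln (4 * real N / \<epsilon>))) \<longrightarrow>
       measure_pmf.prob (gnp N (p N))
         {E. sup_singular_value W * ereal (graph_lambda N E) < 1} \<ge> 1 - \<epsilon>"
  proof (cases "\<epsilon> < 1")
    \<comment> \<open>For \<epsilon> \<ge> 1 the required probability is not positive. The other
      case gives \<open>ln N \<le> ln (4 N / \<epsilon>)\<close>.\<close>
    case False
    then have "1 - \<epsilon> \<le> 0" by simp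
    then show ?thesis
      by (intro always_eventually allI impI) (rule order_trans[OF _ measure_nonneg])
  next
    case True
    have small: "\<forall>\<^sub>F N in sequentially. ln (real N) / (real N * p N) \<le> 1 / 10000"
    proof (rule eventually_mono)
      show "\<forall>\<^sub>F N in sequentially. norm (ln (real N) / (real N * p N)) \<le> 1 / 10000 * norm (1 :: real)"
        using assms(3) by (rule landau_o.smallD) simp
      show "x \<le> 1 / 10000" if "norm x \<le> 1 / 10000 * norm (1 :: real)" for x :: real
        using that unfolding real_norm_def by linarith
    qed
    have "(\<lambda>N. 4 * real N * exp (- (4 / 3) * ln (real N))) \<longlonglongrightarrow> 0" by real_asymp
    then have ev1: "\<forall>\<^sub>F N in sequentially. 4 * real N * exp (- (4 / 3) * ln (real N)) < \<epsilon> / 2"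
      using \<epsilon> by (intro order_tendstoD(2)) auto
    have "(\<lambda>N. real N * exp (- 50 * ln (real N))) \<longlonglongrightarrow> 0" by real_asymp
    then have ev2: "\<forall>\<^sub>F N in sequentially. real N * exp (- 50 * ln (real N)) < \<epsilon> / 2"
      using \<epsilon> by (intro order_tendstoD(2)) auto
    have ev3: "\<forall>\<^sub>F N in sequentially. ln (real N) \<ge> 1" by real_asymp
    show ?thesis
      using small ev1 ev2 ev3 assms(2) eventually_ge_at_top[of "2::nat"]
    proof eventually_elim
      case (elim N)
      \<comment> \<open>Positivity of \<open>p N\<close> matters: division by zero yields 0, so the
        ratio would be small at \<open>p N = 0\<close> too.\<close>
      have "10000 * ln (real N) \<le> real N * p N"
        using elim by (simp add: field_simps)
      then have prob: "measure_pmf.prob (gnp N (p N)) {E. graph_lambda N E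
          \<le> 7 * sqrt (ln (4 * real N / \<epsilon>) / (real N * p N - p N + 1))} \<ge> 1 - \<epsilon>"
        using elim assms(1)[of N] \<epsilon> True by (intro prob_graph_lambda_le) auto
      define L where "L = ln (4 * real N / \<epsilon>)"
      define \<Delta> where "\<Delta> = real N * p N - p N + 1"
      have "1 < 4 * real N / \<epsilon>" using elim(6) \<epsilon> True by (simp add: field_simps)
      then have "L > 0" unfolding L_def by (rule ln_gt_zero)
      moreover have "real N * p N \<ge> 1 * p N" using elim(5,6) by (intro mult_right_mono) auto
      then have "\<Delta> > 0" by (simp add: \<Delta>_def)
      \<comment> \<open>The bound on s is exactly the reciprocal of the high-probability bound on
        \<lambda>.\<close>
      ultimately have "1 / 7 * sqrt (\<Delta> / L) * (7 * sqrt (L / \<Delta>)) = 1"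
        by (simp add: real_sqrt_divide)
      note one = this
      show ?case
      proof (intro allI impI)
        fix C :: nat and W :: "nat \<Rightarrow> real mat"
        assume "sup_singular_value W
          < ereal (1 / 7 * sqrt ((real N * p N - p N + 1) / ln (4 * real N / \<epsilon>)))"
        then have S: "sup_singular_value W < ereal (1 / 7 * sqrt (\<Delta> / L))"
          by (simp add: L_def \<Delta>_def)
        \<comment> \<open>The event on the left does not mention W, so the threshold for N is
          uniform in C and the weights.\<close>
        have "{E. graph_lambda N E \<le> 7 * sqrt (L / \<Delta>)}
            \<subseteq> {E. sup_singular_value W * ereal (graph_lambda N E) < 1}"
          using elim(6) graph_lambda_nonneg[of N] by (auto intro!: ereal_mult_less_one[OF S _ _ one])
        then have "measure_pmf.prob (gnp N (p N)) {E. graph_lambda N E \<le> 7 * sqrt (L / \<Delta>)}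
            \<le> measure_pmf.prob (gnp N (p N)) {E. sup_singular_value W * ereal (graph_lambda N E) < 1}"
          by (intro measure_pmf.finite_measure_mono) auto
        then show "1 - \<epsilon> \<le> measure_pmf.prob (gnp N (p N))
            {E. sup_singular_value W * ereal (graph_lambda N E) < 1}"
          using prob by (simp add: L_def \<Delta>_def)
      qed
    qed
  qed
qed

end
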